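(* There exist a sequence $\{c_k\}_{k=1}^\infty$ of complex numbers with $|c_k|>4$ for all $k$ and a sequence $\{m_k\}_{k=1}^\infty$ of positive integers with $2^{2^{m_k}}\ge 2\sqrt{|c_k|}$ for all $k$ such that, for the associated sequence of quadratic polynomials $\{P_m\}_{m=1}^\infty$ described in the context, for each $m\ge 0$ the set $\mathcal{J}_m$ is pointwise thin and hereditarily non uniformly perfect (HNUP), but $\mathrm{HD}(\mathcal{J}_m)=1$.
   Context: Setup. Given complex numbers $\{c_k\}_{k=1}^\infty$ with $|c_k|>4$ for every $k$ and positive integers $\{m_k\}_{k=1}^\infty$ with $2^{2^{m_k}}\ge 2\sqrt{|c_k|}$ for every $k\ge 1$, put $M_0=0$ and $M_k=\sum_{j=1}^k (m_j+1)$ for $k\ge 1$. The associated sequence of polynomials is: $P_m(z)=z^2+c_k$ if $m=M_k$ for some $k\ge 1$, and $P_m(z)=z^2$ for all other $m\ge 1$. Compositions. For $0\le m\le n$, $Q_{m,n}=P_n\circ\cdots\circ P_{m+2}\circ P_{m+1}$, with $Q_{m,m}=\mathrm{Id}$. Iterated Fatou and Julia sets. For $m\ge 0$, $\mathcal{F}_m$ is the set of $z\in\widehat{\mathbb{C}}$ such that the family $\{Q_{m,n}\}_{n=m}^\infty$ (viewed as maps $\widehat{\mathbb C}\to\widehat{\mathbb C}$, with the spherical topology) is normal on some neighbourhood of $z$, and $\mathcal{J}_m=\widehat{\mathbb{C}}\setminus\mathcal{F}_m$. Annuli. For $z\in\mathbb{C}$ and $0<r<R$ (finite), $\mathrm{A}(z,r,R)=\{w\in\mathbb{C}: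 r<|w-z|<R\}$. A conformal annulus is a doubly connected domain $A\subset\mathbb{C}$ that can be conformally mapped onto some round annulus $\mathrm{A}(z,r,R)$ with $0<r<R$; its modulus is $\operatorname{mod}A=\log(R/r)$ (well defined, since $R/r$ is determined by $A$). A conformal annulus $A$ separates a set $F\subset\mathbb{C}$ if $F\cap A=\emptyset$ and $F$ intersects both components of $\mathbb{C}\setminus A$. Uniformly perfect. A compact set $F\subset\mathbb{C}$ with two or more points is uniformly perfect if there is a uniform upper bound on the moduli of all conformal annuli which separate $F$. HNUP. A compact set $E\subset\mathbb{C}$ is hereditarily non uniformly perfect (HNUP) if no subset of $E$ is uniformly perfect. Pointwise thin. A set $E\subset\mathbb{C}$ is pointwise thin if for each $z\in E$ there exist $0<r_n<R_n$ ($n\in\mathbb{N}$) with $R_n/r_n\to+\infty$ and $R_n\to 0$ such that each round annulus $\mathrm{A}(z,r_n,R_n)$ separates $E$. $\mathrm{HD}$ denotes Hausdorff dimension. *)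

theory Defs
  imports "HOL-Complex_Analysis.Complex_Analysis"
begin

section \<open>The Riemann sphere\<close>

datatype riemann_sphere = Fin complex | Infty

text \<open>Inverse stereographic projection onto the unit sphere of \<open>complex \<times> real\<close>. The metric on
  the Riemann sphere is the chordal one: the Euclidean distance between the projected points.\<close>

definition stereo :: "riemann_sphere \<Rightarrow> complex \<times> real" where
  "stereo p = (case p of
      Fin z \<Rightarrow> (of_real (2 / (1 + (cmod z)\<^sup>2)) * z, ((cmod z)\<^sup>2 - 1) / (1 + (cmod z)\<^sup>2))
    | Infty \<Rightarrow> (0, 1))"

lemma one_plus_norm_sq_pos: "1 + (cmod z)\<^sup>2 > 0"
  by (smt (verit) zero_le_power2)

lemma inj_stereo: "inj stereo"
proof (rule injI)
  fix p q assume eq: "stereo p = stereo q"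
  have height: "((cmod z)\<^sup>2 - 1) / (1 + (cmod z)\<^sup>2) = 1 - 2 / (1 + (cmod z)\<^sup>2)" for z
    using one_plus_norm_sq_pos[of z] by (simp add: field_simps)
  have pos: "2 / (1 + (cmod z)\<^sup>2) > 0" for z
    using one_plus_norm_sq_pos[of z] by simp
  show "p = q"
  proof (cases p)
    case p: (Fin z)
    show ?thesis
    proof (cases q)
      case q: (Fin w)
      have s: "2 / (1 + (cmod z)\<^sup>2) = 2 / (1 + (cmod w)\<^sup>2)"
        using eq p q by (simp add: stereo_def height)
      have "complex_of_real (2 / (1 + (cmod z)\<^sup>2)) * z = of_real (2 / (1 + (cmod z)\<^sup>2)) * w"
        using eq p q s by (simp add: stereo_def)
      then have "z = w"
        using pos[of z] by (metis less_irrefl mult_cancel_left of_real_eq_0_iff)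
      then show ?thesis using p q by simp
    next
      case Infty
      then show ?thesis using eq p pos[of z] by (simp add: stereo_def height)
    qed
  next
    case p: Infty
    show ?thesis
    proof (cases q)
      case (Fin w)
      then show ?thesis using eq p pos[of w] by (simp add: stereo_def height)
    next
      case Infty
      then show ?thesis using p by simp
    qed
  qed
qed

instantiation riemann_sphere :: metric_space
begin

definition dist_riemann_sphere :: "riemann_sphere \<Rightarrow> riemann_sphere \<Rightarrow> real" where
  "dist_riemann_sphere p q = dist (stereo p) (stereo q)"

definition uniformity_riemann_sphere :: "(riemann_sphere \<times> riemann_sphere) filter" where
  "uniformity_riemann_sphere = (INF e\<in>{0 <..}. principal {(x, y). dist x y < e})"

definition open_riemann_sphere :: "riemann_sphere set \<Rightarrow> bool" where
  "open_riemann_sphere U \<longleftrightarrow> (\<forall>x\<in>U. eventually (\<lambda>(x', y). x' = x \<longrightarrow> y \<in> U) uniformity)"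

instance
proof
  fix p q s :: riemann_sphere
  show "dist p q = 0 \<longleftrightarrow> p = q"
    using inj_stereo by (auto simp: dist_riemann_sphere_def dest: injD)
  show "dist p q \<le> dist p s + dist q s"
    by (simp add: dist_riemann_sphere_def dist_triangle2)
qed (simp_all add: uniformity_riemann_sphere_def open_riemann_sphere_def)

end


section \<open>The sequences of quadratic polynomials\<close>

text \<open>Sequences indexed by $k \ge 1$ are functions on \<open>nat\<close>; their value at 0 is never used.\<close>

definition M :: "(nat \<Rightarrow> nat) \<Rightarrow> nat \<Rightarrow> nat" where
  "M ms k = (\<Sum>j=1..k. ms j + 1)"

text \<open>The index \<open>k\<close> below is unique, as \<open>M ms\<close> is strictly increasing.\<close>

definition P :: "(nat \<Rightarrow> complex) \<Rightarrow> (nat \<Rightarrow> nat) \<Rightarrow> nat \<Rightarrow> complex \<Rightarrow> complex" where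
  "P c ms m z =
     (if \<exists>k\<ge>1. m = M ms k then z\<^sup>2 + c (THE k. k \<ge> 1 \<and> m = M ms k) else z\<^sup>2)"

text \<open>\<open>Q c ms m n\<close> is \<open>P\<^sub>n \<circ> \<dots> \<circ> P\<^sub>m\<^sub>+\<^sub>1\<close> for \<open>m \<le> n\<close>; it is only used for such indices.\<close>

primrec Q :: "(nat \<Rightarrow> complex) \<Rightarrow> (nat \<Rightarrow> nat) \<Rightarrow> nat \<Rightarrow> nat \<Rightarrow> complex \<Rightarrow> complex" where
  "Q c ms m 0 = id"
| "Q c ms m (Suc n) = (if m \<le> n then P c ms (Suc n) \<circ> Q c ms m n else id)"

text \<open>Extension of a nonconstant polynomial map to the sphere.\<close>

definition sphere_ext :: "(complex \<Rightarrow> complex) \<Rightarrow> riemann_sphere \<Rightarrow> riemann_sphere" where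
  "sphere_ext f p = (case p of Fin z \<Rightarrow> Fin (f z) | Infty \<Rightarrow> Infty)"


section \<open>Iterated Fatou and Julia sets\<close>

definition normal_on ::
    "(riemann_sphere \<Rightarrow> riemann_sphere) set \<Rightarrow> riemann_sphere set \<Rightarrow> bool" where
  "normal_on \<F> U \<longleftrightarrow>
     (\<forall>f :: nat \<Rightarrow> riemann_sphere \<Rightarrow> riemann_sphere. range f \<subseteq> \<F> \<longrightarrow>
        (\<exists>g r. strict_mono (r :: nat \<Rightarrow> nat) \<and>
           (\<forall>K. compact K \<and> K \<subseteq> U \<longrightarrow> uniform_limit K (f \<circ> r) g sequentially)))"

definition Fatou :: "(nat \<Rightarrow> complex) \<Rightarrow> (nat \<Rightarrow> nat) \<Rightarrow> nat \<Rightarrow> riemann_sphere set" where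
  "Fatou c ms m =
     {p. \<exists>U. open U \<and> p \<in> U \<and> normal_on {sphere_ext (Q c ms m n) | n. n \<ge> m} U}"

definition Julia :: "(nat \<Rightarrow> complex) \<Rightarrow> (nat \<Rightarrow> nat) \<Rightarrow> nat \<Rightarrow> riemann_sphere set" where
  "Julia c ms m = - Fatou c ms m"


section \<open>Annuli, uniform perfectness and pointwise thinness\<close>

definition annulus :: "complex \<Rightarrow> real \<Rightarrow> real \<Rightarrow> complex set" where
  "annulus z r R = {w. r < cmod (w - z) \<and> cmod (w - z) < R}"

definition doubly_connected :: "complex set \<Rightarrow> bool" where
  "doubly_connected A \<longleftrightarrow> card (components (- (Fin ` A))) = 2"

text \<open>\<open>annulus_of_modulus A \<mu>\<close>: \<open>A\<close> is a conformal annulus and \<open>mod A = \<mu>\<close>. The modulus is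
  rendered as a relation; it is single-valued because the ratio \<open>R / r\<close> is a conformal invariant.\<close>

definition annulus_of_modulus :: "complex set \<Rightarrow> real \<Rightarrow> bool" where
  "annulus_of_modulus A \<mu> \<longleftrightarrow>
     open A \<and> connected A \<and> doubly_connected A \<and>
     (\<exists>f z r R. 0 < r \<and> r < R \<and> f holomorphic_on A \<and> inj_on f A \<and> f ` A = annulus z r R \<and>
        \<mu> = ln (R / r))"

text \<open>The two complementary components of a conformal annulus \<open>A\<close> are taken in the sphere. For
  \<open>F \<subseteq> \<complex>\<close> this agrees with using the components of \<open>\<complex> - A\<close> whenever there are exactly two of
  these; removing \<open>\<infinity>\<close> may however disconnect the outer component when \<open>A\<close> is unbounded.\<close>

definition separates :: "complex set \<Rightarrow> complex set \<Rightarrow> bool" where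
  "separates A F \<longleftrightarrow> F \<inter> A = {} \<and> (\<forall>C \<in> components (- (Fin ` A)). Fin ` F \<inter> C \<noteq> {})"

definition uniformly_perfect :: "complex set \<Rightarrow> bool" where
  "uniformly_perfect F \<longleftrightarrow>
     compact F \<and> (\<exists>x\<in>F. \<exists>y\<in>F. x \<noteq> y) \<and>
     (\<exists>B. \<forall>A \<mu>. annulus_of_modulus A \<mu> \<and> separates A F \<longrightarrow> \<mu> \<le> B)"

definition HNUP :: "complex set \<Rightarrow> bool" where
  "HNUP E \<longleftrightarrow> compact E \<and> (\<forall>F\<subseteq>E. \<not> uniformly_perfect F)"

definition pointwise_thin :: "complex set \<Rightarrow> bool" where
  "pointwise_thin E \<longleftrightarrow>
     (\<forall>z\<in>E. \<exists>r R :: nat \<Rightarrow> real.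
        (\<forall>n. 0 < r n \<and> r n < R n) \<and>
        filterlim (\<lambda>n. R n / r n) at_top sequentially \<and> R \<longlonglongrightarrow> 0 \<and>
        (\<forall>n. separates (annulus z (r n) (R n)) E))"


section \<open>Hausdorff dimension\<close>

text \<open>Hausdorff measures are only used for exponents \<open>s > 0\<close>, where \<open>0 powr s = 0\<close> is the right
  value for empty and one-point sets. Boundedness is required of the covering sets because
  \<open>diameter\<close> is unspecified for unbounded sets.\<close>

definition hausdorff_content :: "real \<Rightarrow> real \<Rightarrow> 'a::metric_space set \<Rightarrow> ennreal" where
  "hausdorff_content s \<delta> E =
     (INF U \<in> {U :: nat \<Rightarrow> 'a set. E \<subseteq> (\<Union>i. U i) \<and> (\<forall>i. bounded (U i) \<and> diameter (U i) \<le> \<delta>)}.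
        \<Sum>i. ennreal (diameter (U i) powr s))"

definition hausdorff_measure :: "real \<Rightarrow> 'a::metric_space set \<Rightarrow> ennreal" where
  "hausdorff_measure s E = (SUP \<delta> \<in> {0<..}. hausdorff_content s \<delta> E)"

definition HD :: "'a::metric_space set \<Rightarrow> ennreal" where
  "HD E = (INF s \<in> {s :: real. s > 0 \<and> hausdorff_measure s E = 0}. ennreal s)"

end

theory Submission
  imports Defs
begin

text \<open>
  The parameters are \<open>c\<^sub>k = 64\<^sup>k\<close>, which tend to infinity and so produce thick separating annuli, and
  numbers of squarings so large that the degrees \<open>d\<^sub>k\<close> of the block maps \<open>z \<mapsto> z ^ d\<^sub>k + c\<^sub>k\<close> dwarf every
  power of the \<open>c\<^sub>k\<close>, which pushes the dimension up to 1.

  \<^bold>\<open>Survivors.\<close> A point that has modulus above 2 at the end of a block at least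
  doubles its modulus with every later block, so it escapes to infinity, and it does so uniformly on
  the set of points that have left by a fixed time. Hence such points belong to the Fatou set. The
  survivors, whose modulus is at most 2 at the end of every block, lie in the Julia set as soon as
  every survivor is a limit of escaping points: a continuous limit function cannot be infinite at the
  escaping points and finite at the survivor (\<open>Julia_eq_survivors\<close>). From any starting time \<open>m\<close>, the
  survivors form a set of the kind studied in the locale \<open>cantor\<close>, the first degree being smaller
  if \<open>m\<close> lies inside a block.

  \<^bold>\<open>Geometry of a block.\<close> The preimage of the closed disc of radius 2 under \<open>z \<mapsto> z ^ d + c\<close> consists of
  \<open>d\<close> small pieces around the roots \<open>\<zeta>\<close> of \<open>\<zeta> ^ d = - c\<close>, namely the images of the inverse branches
  \<open>w \<mapsto> \<zeta> * (1 - w / c) ^ (1 / d)\<close>. A piece has diameter at most of the order of \<open>1 / (d c)\<close>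
  (\<open>same_root_contraction\<close>), distinct pieces are at least \<open>1 / d\<close> apart
  (\<open>different_roots_separated\<close>), and distances grow at most by the factor \<open>d (c + 2)\<close>
  (\<open>F_Suc_expansion_le\<close>). Every point is coded by the sequence of roots that it follows.

  \<^bold>\<open>Thinness.\<close> Points with the same first \<open>n + 1\<close> roots as \<open>z\<close> are within \<open>4 \<Delta>\<^sub>n\<^sub>+\<^sub>1\<close> of \<open>z\<close>, and all others
  are at least \<open>\<delta>\<^sub>n\<close> away. The ratio of the two radii is at least of the order of \<open>c\<^sub>n / 8\<^sup>n\<close>; the
  exponential loss comes from comparing the cruder bounds at earlier stages, and the geometric growth
  of \<open>c\<^sub>n\<close> makes up for it. A compact pointwise thin set is hereditarily non uniformly perfect because
  the thin annuli around a point of a subset separate that subset as well once they are small.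

  \<^bold>\<open>Dimension.\<close> There are \<open>N\<^sub>n = d\<^sub>0 \<cdots> d\<^sub>n\<^sub>-\<^sub>1\<close> pieces of level \<open>n\<close>, and the sum of their diameters tends to 0,
  so the dimension is at most 1. For the lower bound at an exponent \<open>s < 1\<close>, a set of diameter \<open>t\<close>
  between the scales \<open>\<delta>\<^sub>n\<close> and \<open>\<delta>\<^sub>n\<^sub>-\<^sub>1\<close> follows a single word of \<open>n\<close> roots, and after \<open>n\<close> blocks its
  points spread over a distance of at most \<open>\<tau> = \<Lambda>\<^sub>n t\<close>. Since the roots lie on a circle, it meets only
  \<open>O(d\<^sub>n \<tau>)\<close> of the next pieces. It therefore meets at most a fraction of the order of
  \<open>min 1 \<tau> / N\<^sub>n \<le> \<tau>\<^sup>s / N\<^sub>n\<close> of the pieces of each deeper level, which is \<open>O(t\<^sup>s)\<close> because the degrees grow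
  so fast (\<open>card_codes_le\<close>). Counting pieces of a deep level then bounds the \<open>s\<close>-sum of every finite
  open cover from below (\<open>hausdorff_measure_E_pos\<close>).
\<close>

section \<open>The Riemann sphere and round annuli\<close>

lemma continuous_stereo: "continuous_on UNIV stereo"
  unfolding continuous_on_iff dist_riemann_sphere_def by blast

lemma continuous_Fin: "continuous_on UNIV Fin"
proof -
  have ne: "1 + (cmod z)\<^sup>2 \<noteq> 0" for z
    using one_plus_norm_sq_pos[of z] by simp
  have "continuous_on UNIV (\<lambda>z. stereo (Fin z))"
    unfolding stereo_def riemann_sphere.case
    by (intro continuous_intros) (simp_all add: ne del: of_real_add)
  then show ?thesis
    unfolding continuous_on_iff dist_riemann_sphere_def by blast
qed

lemma dist_Fin_Infty: "dist (Fin z) Infty = 2 / sqrt (1 + (cmod z)\<^sup>2)"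
proof -
  let ?q = "1 + (cmod z)\<^sup>2"
  have q: "?q > 0" by (rule one_plus_norm_sq_pos)
  have cancel: "(2 / x)\<^sup>2 * x = 4 / x" if "x > 0" for x :: real
    using that by (simp add: power2_eq_square)
  have "dist (Fin z) Infty
      = sqrt ((cmod (of_real (2 / ?q) * z))\<^sup>2 + (((cmod z)\<^sup>2 - 1) / ?q - 1)\<^sup>2)"
    by (simp add: dist_riemann_sphere_def stereo_def dist_prod_def dist_norm)
  also have "(cmod (of_real (2 / ?q) * z))\<^sup>2 + (((cmod z)\<^sup>2 - 1) / ?q - 1)\<^sup>2
      = (2 / ?q)\<^sup>2 * ((cmod z)\<^sup>2) + (2 / ?q)\<^sup>2"
  proof -
    have "((cmod z)\<^sup>2 - 1) / ?q - 1 = - (2 / ?q)" using q by (simp add: field_simps)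
    moreover have "cmod (of_real (2 / ?q) * z) = 2 / ?q * cmod z"
      unfolding norm_mult norm_of_real using q by simp
    ultimately show ?thesis by (simp only: power_mult_distrib power2_minus)
  qed
  also have "\<dots> = (2 / ?q)\<^sup>2 * ?q" by (simp only: distrib_left mult_1_right add.commute)
  also have "\<dots> = 4 / ?q" by (rule cancel[OF q])
  finally show ?thesis by (simp add: real_sqrt_divide)
qed

lemma Fin_tendsto_Infty: "(Fin \<longlongrightarrow> Infty) at_infinity"
proof (rule metric_tendsto_imp_tendsto[where f="\<lambda>z. 2 / cmod z" and a=0])
  show "((\<lambda>z. 2 / cmod z) \<longlongrightarrow> 0) at_infinity"
    by (intro tendsto_divide_0[OF tendsto_const] filterlim_at_top_imp_at_infinity
        filterlim_norm_at_top)
  have "dist (Fin z) Infty \<le> 2 / cmod z" if "1 \<le> cmod z" for z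
  proof -
    have "cmod z \<le> sqrt (1 + (cmod z)\<^sup>2)" by (rule real_le_rsqrt) simp
    moreover have "sqrt (1 + (cmod z)\<^sup>2) > 0"
      using one_plus_norm_sq_pos[of z] by (simp only: real_sqrt_gt_0_iff)
    ultimately show ?thesis
      unfolding dist_Fin_Infty using that by (intro divide_left_mono mult_pos_pos) auto
  qed
  then show "\<forall>\<^sub>F z in at_infinity. dist (Fin z) Infty \<le> dist (2 / cmod z) 0"
    unfolding eventually_at_infinity by (intro exI[of _ 1]) auto
qed

text \<open>Off the north pole the stereographic projection has a continuous inverse, so the plane
  carries its usual topology as an open subset of the sphere.\<close>

lemma open_Fin_image:
  assumes "open U"
  shows "open (Fin ` U)"
proof -
  define v where "v p = (1 / (1 - snd (stereo p))) *\<^sub>R fst (stereo p)" for p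
  have height: "1 - ((cmod z)\<^sup>2 - 1) / (1 + (cmod z)\<^sup>2) = 2 / (1 + (cmod z)\<^sup>2)" for z
    using one_plus_norm_sq_pos[of z] by (simp add: field_simps)
  have v: "v (Fin z) = z" for z
  proof -
    let ?q = "2 / (1 + (cmod z)\<^sup>2)"
    have "v (Fin z) = of_real (1 / ?q) * (of_real ?q * z)"
      unfolding v_def stereo_def riemann_sphere.case fst_conv snd_conv height
      by (simp only: scaleR_conv_of_real)
    also have "\<dots> = of_real (1 / ?q * ?q) * z"
      by (simp only: of_real_mult mult.assoc)
    also have "1 / ?q * ?q = 1"
      using one_plus_norm_sq_pos[of z] by simp
    finally show ?thesis by simp
  qed
  define W where "W = {p. snd (stereo p) < 1}"
  have W: "p \<in> W \<longleftrightarrow> p \<noteq> Infty" for p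
    using one_plus_norm_sq_pos by (cases p) (auto simp: W_def stereo_def)
  have "open W" unfolding W_def
    by (intro open_Collect_less continuous_on_snd continuous_stereo continuous_on_const)
  moreover have "continuous_on W v"
    unfolding v_def using continuous_on_subset[OF continuous_stereo, of W]
    by (intro continuous_intros) (auto simp: W_def)
  ultimately have "open (W \<inter> v -` U)"
    using assms by (metis continuous_open_preimage)
  moreover have "W \<inter> v -` U = Fin ` U"
  proof (rule set_eqI)
    fix p show "p \<in> W \<inter> v -` U \<longleftrightarrow> p \<in> Fin ` U"
      by (cases p) (auto simp: W v)
  qed
  ultimately show ?thesis by simp
qed

lemma closed_Fin_compact_image: "compact K \<Longrightarrow> closed (Fin ` K)"
  by (intro compact_imp_closed compact_continuous_image
      continuous_on_subset[OF continuous_Fin]) auto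

lemma sphere_minus_annulus:
  assumes "0 < r" "r < R"
  shows "- (Fin ` annulus z r R) = Fin ` cball z r \<union> - (Fin ` ball z R)"
proof (rule set_eqI)
  fix p show "p \<in> - (Fin ` annulus z r R) \<longleftrightarrow> p \<in> Fin ` cball z r \<union> - (Fin ` ball z R)"
    using assms
    by (cases p) (auto simp: annulus_def dist_norm norm_minus_commute image_iff not_less)
qed

lemma connected_sphere_outside_ball: "connected (- (Fin ` ball (z::complex) R))"
proof -
  have conn: "connected (Fin ` (- ball z R))"
    by (intro connected_continuous_image continuous_on_subset[OF continuous_Fin]
        connected_complement_bounded_convex) auto
  have "Infty \<in> closure (Fin ` (- ball z R))"
    unfolding closure_approachable
  proof (intro allI impI)
    fix e :: real assume "0 < e"
    then obtain b where b: "\<And>w. b \<le> cmod w \<Longrightarrow> dist (Fin w) Infty < e"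
      using tendstoD[OF Fin_tendsto_Infty] unfolding eventually_at_infinity by blast
    define x where "x = complex_of_real (\<bar>b\<bar> + \<bar>R\<bar> + cmod z)"
    have x: "cmod x = \<bar>b\<bar> + \<bar>R\<bar> + cmod z"
      unfolding x_def by (simp only: norm_of_real) simp
    have "x \<in> - ball z R"
      using norm_triangle_ineq2[of x z] x by (simp add: dist_norm norm_minus_commute)
    moreover have "dist (Fin x) Infty < e"
      by (rule b) (use x norm_ge_zero[of z] in linarith)
    ultimately show "\<exists>y\<in>Fin ` (- ball z R). dist y Infty < e" by blast
  qed
  moreover have "- (Fin ` ball z R) \<subseteq> insert Infty (Fin ` (- ball z R))"
  proof
    fix p assume "p \<in> - (Fin ` ball z R)"
    then show "p \<in> insert Infty (Fin ` (- ball z R))" by (cases p) auto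
  qed
  ultimately show ?thesis
    by (intro connected_intermediate_closure[OF conn]) (auto intro: closure_subset[THEN subsetD])
qed

text \<open>The two sets are relatively clopen in their union.\<close>

lemma components_Un_closed:
  fixes A B :: "'a::topological_space set"
  assumes closed: "closed A" "closed B" and conn: "connected A" "connected B"
    and ne: "A \<noteq> {}" "B \<noteq> {}" and disj: "A \<inter> B = {}"
  shows "components (A \<union> B) = {A, B}"
proof -
  have sep: "T \<subseteq> A \<or> T \<subseteq> B" if "connected T" "T \<subseteq> A \<union> B" for T
    using connected_closedD[OF that(1) _ that(2) closed] disj that(2) by blast
  have A: "A \<in> components (A \<union> B)"
    unfolding in_components_maximal
  proof (intro conjI allI impI)
    fix T assume T: "T \<noteq> {} \<and> A \<subseteq> T \<and> T \<subseteq> A \<union> B \<and> connected T"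
    then have "\<not> T \<subseteq> B" using ne disj by blast
    then show "T = A" using T sep[of T] by blast
  qed (use ne conn in simp_all)
  have B: "B \<in> components (A \<union> B)"
    unfolding in_components_maximal
  proof (intro conjI allI impI)
    fix T assume T: "T \<noteq> {} \<and> B \<subseteq> T \<and> T \<subseteq> A \<union> B \<and> connected T"
    then have "\<not> T \<subseteq> A" using ne disj by blast
    then show "T = B" using T sep[of T] by blast
  qed (use ne conn in simp_all)
  have "C = A \<or> C = B" if "C \<in> components (A \<union> B)" for C
  proof -
    have "C \<noteq> {}" "C \<subseteq> A \<union> B"
      using in_components_nonempty[OF that] in_components_subset[OF that] by auto
    then have "C \<inter> A \<noteq> {} \<or> C \<inter> B \<noteq> {}" by blast
    then show ?thesis
      using components_eq[OF that A] components_eq[OF that B] by blast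
  qed
  then show ?thesis using A B by blast
qed

lemma components_sphere_minus_annulus:
  assumes "0 < r" "r < R"
  shows "components (- (Fin ` annulus z r R)) = {Fin ` cball z r, - (Fin ` ball z R)}"
  unfolding sphere_minus_annulus[OF assms]
proof (rule components_Un_closed)
  show "closed (Fin ` cball z r)" "closed (- (Fin ` ball z R))"
    by (auto intro: closed_Fin_compact_image open_Fin_image)
  show "connected (Fin ` cball z r)"
    by (intro connected_continuous_image continuous_on_subset[OF continuous_Fin]) auto
  show "connected (- (Fin ` ball z R))" by (rule connected_sphere_outside_ball)
  show "Fin ` cball z r \<inter> - (Fin ` ball z R) = {}" using assms by auto
  have "Infty \<in> - (Fin ` ball z R)" by auto
  then show "- (Fin ` ball z R) \<noteq> {}" by blast
qed (use assms in simp)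

lemma annulus_of_modulus_round:
  assumes "0 < r" "r < R"
  shows "annulus_of_modulus (annulus z r R) (ln (R / r))"
proof -
  have "open (annulus z r R)"
    unfolding annulus_def by (intro open_Collect_conj open_Collect_less continuous_intros)
  moreover have "connected (annulus z r R)"
    using connected_annulus[of r z R] by (simp add: annulus_def)
  moreover have "doubly_connected (annulus z r R)"
  proof -
    have "Fin z \<in> Fin ` cball z r" "Fin z \<notin> - (Fin ` ball z R)" using assms by auto
    then have "Fin ` cball z r \<noteq> - (Fin ` ball z R)" by blast
    then show ?thesis
      unfolding doubly_connected_def components_sphere_minus_annulus[OF assms] by simp
  qed
  moreover have "id holomorphic_on annulus z r R" "inj_on id (annulus z r R)"
    "id ` annulus z r R = annulus z r R" by (simp_all add: id_def)
  ultimately show ?thesis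
    unfolding annulus_of_modulus_def using assms by blast
qed

text \<open>This replaces the components of the complement on the sphere by conditions in the plane.\<close>

lemma separates_round_annulus:
  assumes "0 < r" "r < R"
  shows "separates (annulus z r R) F \<longleftrightarrow>
    F \<inter> annulus z r R = {} \<and> F \<inter> cball z r \<noteq> {} \<and> \<not> F \<subseteq> ball z R"
  unfolding separates_def components_sphere_minus_annulus[OF assms] by auto

text \<open>Annuli around one point of a subset with at least two points separate that subset as soon as
  they are small enough, and their moduli are unbounded.\<close>

lemma pointwise_thin_imp_HNUP:
  assumes "compact E" "pointwise_thin E"
  shows "HNUP E"
  unfolding HNUP_def
proof (intro conjI allI impI notI)
  fix F assume "F \<subseteq> E" "uniformly_perfect F"
  then obtain x y B where xy: "x \<in> F" "y \<in> F" "x \<noteq> y"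
    and B: "\<And>A \<mu>. annulus_of_modulus A \<mu> \<Longrightarrow> separates A F \<Longrightarrow> \<mu> \<le> B"
    unfolding uniformly_perfect_def by blast
  then obtain r R :: "nat \<Rightarrow> real" where rR: "\<And>n. 0 < r n" "\<And>n. r n < R n"
    and ratio: "filterlim (\<lambda>n. R n / r n) at_top sequentially" and R0: "R \<longlonglongrightarrow> 0"
    and sep: "\<And>n. separates (annulus x (r n) (R n)) E"
    using assms(2) \<open>F \<subseteq> E\<close> unfolding pointwise_thin_def by blast
  have "eventually (\<lambda>n. R n < dist x y) sequentially"
    using R0 xy by (auto intro: order_tendstoD)
  moreover have "eventually (\<lambda>n. R n / r n > exp B) sequentially"
    using ratio by (auto simp: filterlim_at_top_dense)
  ultimately have "eventually (\<lambda>n. R n < dist x y \<and> R n / r n > exp B) sequentially"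
    by eventually_elim auto
  then obtain n where n: "R n < dist x y" "R n / r n > exp B"
    unfolding eventually_sequentially by blast
  have "separates (annulus x (r n) (R n)) F"
    using sep[of n] xy \<open>F \<subseteq> E\<close> n(1) rR(1)[of n]
    unfolding separates_round_annulus[OF rR] by (fastforce simp: not_less)
  with B annulus_of_modulus_round[OF rR] have "ln (R n / r n) \<le> B" by blast
  then have "R n / r n \<le> exp B"
    using rR[of n] by (metis divide_pos_pos exp_le_cancel_iff exp_ln order_less_trans)
  then show False using n(2) by simp
qed (fact assms)

section \<open>Hausdorff measure and finite covers\<close>

lemma hausdorff_content_le_finite_cover:
  assumes "finite I" and "E \<subseteq> (\<Union>i\<in>I. V i)"
    and "\<And>i. i \<in> I \<Longrightarrow> bounded (V i) \<and> diameter (V i) \<le> \<delta>" and "0 \<le> \<delta>"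
  shows "hausdorff_content s \<delta> E \<le> (\<Sum>i\<in>I. ennreal (diameter (V i) powr s))"
proof -
  obtain b where b: "bij_betw b {..<card I} I"
    using ex_bij_betw_nat_finite[OF assms(1)] by (auto simp: atLeast0LessThan)
  define U where "U i = (if i < card I then V (b i) else {})" for i
  have "E \<subseteq> (\<Union>i. U i)"
  proof
    fix x assume "x \<in> E"
    then obtain i where "i \<in> I" "x \<in> V i" using assms(2) by blast
    moreover then obtain j where "j < card I" "b j = i"
      using b unfolding bij_betw_def by force
    ultimately have "x \<in> U j" by (simp add: U_def)
    then show "x \<in> (\<Union>i. U i)" by blast
  qed
  moreover have "bounded (U i) \<and> diameter (U i) \<le> \<delta>" for i
    using assms(3)[of "b i"] assms(4) b unfolding bij_betw_def by (auto simp: U_def)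
  ultimately have "hausdorff_content s \<delta> E \<le> (\<Sum>i. ennreal (diameter (U i) powr s))"
    unfolding hausdorff_content_def by (intro INF_lower) auto
  also have "\<dots> = (\<Sum>i<card I. ennreal (diameter (U i) powr s))"
    by (rule suminf_finite) (auto simp: U_def)
  also have "\<dots> = (\<Sum>i<card I. ennreal (diameter (V (b i)) powr s))"
    by (simp add: U_def)
  also have "\<dots> = (\<Sum>i\<in>I. ennreal (diameter (V i) powr s))"
    using sum.reindex_bij_betw[OF b, of "\<lambda>i. ennreal (diameter (V i) powr s)"] by simp
  finally show ?thesis .
qed

text \<open>The covering sets may be enlarged to open sets at an arbitrarily small cost, and then
  compactness leaves finitely many of them.\<close>

lemma hausdorff_content_ge_open_covers:
  fixes E :: "'a::metric_space set"
  assumes "compact E" and "0 < s" and "0 < \<kappa>"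
    and covers: "\<And>(I :: nat set) V t. finite I \<Longrightarrow> E \<subseteq> (\<Union>i\<in>I. V i) \<Longrightarrow>
      (\<And>i. i \<in> I \<Longrightarrow> open (V i) \<and> 0 < t i \<and> (\<forall>x\<in>V i. \<forall>y\<in>V i. dist x y \<le> t i)) \<Longrightarrow>
      2 * \<kappa> \<le> (\<Sum>i\<in>I. t i powr s)"
  shows "ennreal \<kappa> \<le> hausdorff_content s \<delta> E"
  unfolding hausdorff_content_def
proof (rule INF_greatest)
  fix U :: "nat \<Rightarrow> 'a set"
  assume "U \<in> {U. E \<subseteq> (\<Union>i. U i) \<and> (\<forall>i. bounded (U i) \<and> diameter (U i) \<le> \<delta>)}"
  then have cov: "E \<subseteq> (\<Union>i. U i)" and bdd: "\<And>i. bounded (U i)" by auto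
  define a where "a i = diameter (U i)" for i
  have a: "a i \<ge> 0" for i unfolding a_def using bdd by (rule diameter_ge_0)
  have "\<exists>\<eta>>0. (a i + 2 * \<eta>) powr s < a i powr s + \<kappa> * (1 / 2) ^ Suc i" for i
  proof -
    have "((\<lambda>\<eta>. (a i + 2 * \<eta>) powr s) \<longlongrightarrow> (a i + 2 * 0) powr s) (at_right 0)"
    proof (rule tendsto_powr2)
      show "((\<lambda>\<eta>. a i + 2 * \<eta>) \<longlongrightarrow> a i + 2 * 0) (at_right 0)" by (intro tendsto_intros)
      show "\<forall>\<^sub>F \<eta> in at_right 0. 0 \<le> a i + 2 * \<eta>"
        using a[of i] by (auto simp: eventually_at_right_field intro!: exI[of _ 1])
    qed (use assms(2) in auto)
    then have "\<forall>\<^sub>F \<eta> in at_right 0. (a i + 2 * \<eta>) powr s < a i powr s + \<kappa> * (1 / 2) ^ Suc i"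
      by (rule order_tendstoD) (use assms(3) in simp)
    then obtain b where b: "b > 0" "\<And>\<eta>. 0 < \<eta> \<Longrightarrow> \<eta> < b \<Longrightarrow>
        (a i + 2 * \<eta>) powr s < a i powr s + \<kappa> * (1 / 2) ^ Suc i"
      unfolding eventually_at_right_field by auto
    then show ?thesis using b(2)[of "b / 2"] by (intro exI[of _ "b / 2"]) auto
  qed
  then obtain \<eta> where \<eta>: "\<And>i. \<eta> i > 0"
    "\<And>i. (a i + 2 * \<eta> i) powr s < a i powr s + \<kappa> * (1 / 2) ^ Suc i"
    by metis
  define V where "V i = (\<Union>u\<in>U i. ball u (\<eta> i))" for i
  have "E \<subseteq> (\<Union>i\<in>UNIV. V i)"
  proof
    fix x assume "x \<in> E"
    then obtain i where "x \<in> U i" using cov by blast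
    then have "x \<in> V i" unfolding V_def using \<eta>(1)[of i] by (auto intro!: bexI[of _ x])
    then show "x \<in> (\<Union>i\<in>UNIV. V i)" by blast
  qed
  moreover have openV: "open (V i)" for i unfolding V_def by blast
  ultimately obtain I where I: "finite I" "E \<subseteq> (\<Union>i\<in>I. V i)"
    using compactE_image[OF assms(1), of UNIV V] by auto
  have dist: "dist x y \<le> a i + 2 * \<eta> i" if xy: "x \<in> V i" "y \<in> V i" for i x y
  proof -
    obtain u where u: "u \<in> U i" "dist u x < \<eta> i" using xy(1) unfolding V_def by auto
    obtain v where v: "v \<in> U i" "dist v y < \<eta> i" using xy(2) unfolding V_def by auto
    have "dist x y \<le> dist x u + dist u v + dist v y"
      using dist_triangle[of x y u] dist_triangle[of u y v] by linarith
    moreover have "dist u v \<le> a i"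
      unfolding a_def using bdd u v by (intro diameter_bounded_bound)
    ultimately show ?thesis using u v by (simp add: dist_commute)
  qed
  have half: "(\<Sum>i\<in>I. (1 / 2 :: real) ^ Suc i) \<le> 1"
    using sum_le_suminf[OF sums_summable[OF power_half_series] I(1)]
      sums_unique[OF power_half_series] by simp
  have "2 * \<kappa> \<le> (\<Sum>i\<in>I. (a i + 2 * \<eta> i) powr s)"
    by (rule covers[OF I]) (use openV dist a \<eta> in \<open>auto intro: add_nonneg_pos\<close>)
  also have "\<dots> \<le> (\<Sum>i\<in>I. a i powr s + \<kappa> * (1 / 2) ^ Suc i)"
    by (intro sum_mono less_imp_le \<eta>)
  also have "\<dots> = (\<Sum>i\<in>I. a i powr s) + \<kappa> * (\<Sum>i\<in>I. (1 / 2) ^ Suc i)"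
    by (simp add: sum.distrib sum_distrib_left)
  also have "\<dots> \<le> (\<Sum>i\<in>I. a i powr s) + \<kappa>"
    using half assms(3) by (simp add: mult_left_le)
  finally have "\<kappa> \<le> (\<Sum>i\<in>I. a i powr s)" by simp
  then have "ennreal \<kappa> \<le> (\<Sum>i\<in>I. ennreal (a i powr s))"
    by (simp add: sum_ennreal ennreal_leI)
  also have "\<dots> \<le> (\<Sum>i. ennreal (a i powr s))"
    by (rule sum_le_suminf) (use I in auto)
  finally show "ennreal \<kappa> \<le> (\<Sum>i. ennreal (diameter (U i) powr s))"
    unfolding a_def .
qed

lemma HD_eq_1I:
  assumes "hausdorff_measure 1 E = 0"
    and "\<And>s. 0 < s \<Longrightarrow> s < 1 \<Longrightarrow> hausdorff_measure s E \<noteq> 0"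
  shows "HD E = 1"
  unfolding HD_def
proof (rule antisym)
  have "(INF s \<in> {s. s > 0 \<and> hausdorff_measure s E = 0}. ennreal s) \<le> ennreal 1"
    using assms(1) by (intro INF_lower) auto
  then show "(INF s \<in> {s. s > 0 \<and> hausdorff_measure s E = 0}. ennreal s) \<le> 1" by simp
  show "1 \<le> (INF s \<in> {s. s > 0 \<and> hausdorff_measure s E = 0}. ennreal s)"
    using assms(2) by (intro INF_greatest) (auto simp: not_less[symmetric])
qed

lemma hausdorff_measure_subset_singleton:
  assumes "0 < s" and "E \<subseteq> {x}"
  shows "hausdorff_measure s E = 0"
proof -
  have "hausdorff_content s \<delta> E \<le> 0" if "0 < \<delta>" for \<delta>
    using hausdorff_content_le_finite_cover[of "{x}" E "\<lambda>x. {x}" \<delta> s] assms that by simp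
  then show ?thesis unfolding hausdorff_measure_def by (auto intro!: antisym SUP_least)
qed

section \<open>Roots of unity\<close>

text \<open>Telescoping, applied below both to powers of a root of unity and to the block maps.\<close>

lemma norm_power_diff_le:
  fixes a b :: "'a::real_normed_field"
  assumes "norm a \<le> R" "norm b \<le> R"
  shows "norm (a ^ n - b ^ n) \<le> real n * R ^ (n - 1) * norm (a - b)"
proof (induction n)
  case (Suc n)
  have R: "0 \<le> R" using assms(1) norm_ge_zero order_trans by blast
  have "a ^ Suc n - b ^ Suc n = a * (a ^ n - b ^ n) + b ^ n * (a - b)"
    by (simp add: algebra_simps)
  then have "norm (a ^ Suc n - b ^ Suc n)
      \<le> norm a * norm (a ^ n - b ^ n) + norm b ^ n * norm (a - b)"
    by (metis norm_mult norm_power norm_triangle_ineq)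
  also have "\<dots> \<le> R * (real n * R ^ (n - 1) * norm (a - b)) + R ^ n * norm (a - b)"
    using assms Suc R by (intro add_mono mult_mono mult_right_mono power_mono) auto
  also have "\<dots> = real (Suc n) * R ^ (Suc n - 1) * norm (a - b)"
    by (cases n) (auto simp: algebra_simps)
  finally show ?case .
qed simp

text \<open>The terms \<open>1 - \<omega> ^ i\<close> for \<open>i < n\<close> sum to \<open>n\<close> because the powers sum to 0, and each of them has modulus at
  most \<open>i\<close> times that of \<open>1 - \<omega>\<close>.\<close>

lemma root_of_unity_dist_1:
  fixes \<omega> :: complex
  assumes "\<omega> ^ n = 1" "\<omega> \<noteq> 1" "0 < n"
  shows "2 / real n \<le> cmod (1 - \<omega>)"
proof -
  have "(\<Sum>i<n. \<omega> ^ i) = 0"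
    using assms by (simp add: geometric_sum)
  then have "of_nat n = (\<Sum>i<n. 1 - \<omega> ^ i)"
    by (simp add: sum_subtractf)
  then have "real n = cmod (\<Sum>i<n. 1 - \<omega> ^ i)"
    by (metis norm_of_nat)
  also have "\<dots> \<le> (\<Sum>i<n. cmod (1 - \<omega> ^ i))" by (rule norm_sum)
  also have "\<dots> \<le> (\<Sum>i<n. real i * cmod (1 - \<omega>))"
  proof (rule sum_mono)
    have "cmod \<omega> ^ n = 1" using assms(1) by (metis norm_one norm_power)
    then have "cmod \<omega> = 1" using assms(1,3) power_eq_1_iff by blast
    then show "cmod (1 - \<omega> ^ i) \<le> real i * cmod (1 - \<omega>)" for i
      using norm_power_diff_le[of 1 1 \<omega> i] by simp
  qed
  also have "\<dots> = (\<Sum>i<n. real i) * cmod (1 - \<omega>)" by (simp add: sum_distrib_right)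
  also have "(\<Sum>i<n. real i) \<le> real n * real n / 2"
    by (induction n) (auto simp: field_simps)
  finally have "real n \<le> real n * real n / 2 * cmod (1 - \<omega>)"
    by (simp add: mult_right_mono)
  then show ?thesis using assms(3) by (simp add: field_simps)
qed

lemma sin_ge_linear:
  assumes "0 \<le> x" "x \<le> pi / 2"
  shows "x / pi \<le> sin x"
proof (cases "x \<le> pi / 3")
  case True
  show ?thesis
  proof (cases "x = 0")
    case False
    then have "0 < x" using assms by simp
    then obtain y where y: "0 < y" "y < x" "sin x - sin 0 = (x - 0) * cos y"
      using MVT2[of 0 x sin cos] DERIV_sin by blast
    have "1 / 2 \<le> cos y"
      using cos_monotone_0_pi_le[of y "pi / 3"] y True pi_gt_zero by (simp add: cos_60)
    then have "x * (1 / 2) \<le> x * cos y" using assms by (intro mult_left_mono)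
    moreover have "x / pi \<le> x / 2" using assms pi_gt3 by (intro divide_left_mono) auto
    ultimately show ?thesis using y(3) by (simp only: sin_zero diff_zero)
  qed simp
next
  case False
  have "sin (pi / 6) \<le> sin x"
    using assms False pi_gt_zero by (intro sin_monotone_2pi_le) auto
  moreover have "x / pi \<le> 1 / 2" using assms pi_gt_zero by (simp add: field_simps)
  ultimately show ?thesis unfolding sin_30 by linarith
qed

text \<open>The roots of unity are spread along a curve: the number of them in a disc is linear in the
  radius, whereas separation alone would only give a quadratic bound.\<close>

lemma card_roots_of_unity_near_1:
  assumes "0 < n" "0 \<le> \<sigma>"
  shows "real (card {\<omega>::complex. \<omega> ^ n = 1 \<and> cmod (\<omega> - 1) \<le> \<sigma>}) \<le> 2 * \<sigma> * real n + 1"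
proof -
  define e where "e j = exp (\<i> * of_real (2 * pi * real_of_int j / real n))" for j
  define B where "B = \<lfloor>\<sigma> * real n\<rfloor>"
  have B: "0 \<le> B" using assms by (simp add: B_def)
  have "{\<omega>::complex. \<omega> ^ n = 1 \<and> cmod (\<omega> - 1) \<le> \<sigma>} \<subseteq> e ` {-B..B}"
  proof
    fix \<omega> :: complex
    assume "\<omega> \<in> {\<omega>. \<omega> ^ n = 1 \<and> cmod (\<omega> - 1) \<le> \<sigma>}"
    then have \<omega>: "\<omega> ^ n = 1" "cmod (\<omega> - 1) \<le> \<sigma>" by auto
    obtain j where j: "j < n" "\<omega> = exp (2 * of_real pi * \<i> * of_nat j / of_nat n)"
      using \<omega>(1) complex_roots_unity[of n] assms(1) by (auto simp: set_eq_iff)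
    have ej: "\<omega> = e (int j)" unfolding j(2) e_def by (simp add: mult_ac)
    \<comment> \<open>Choose the argument in \<open>[-\<pi>, \<pi>]\<close>, where the chord is comparable to the arc.\<close>
    obtain i where i: "\<omega> = e i" "2 * \<bar>i\<bar> \<le> int n"
    proof (cases "2 * j \<le> n")
      case True
      then show ?thesis using that[of "int j"] ej by simp
    next
      case False
      have "\<i> * of_real (2 * pi * real_of_int (int j - int n) / real n)
          = \<i> * of_real (2 * pi * real_of_int (int j) / real n) - 2 * of_real pi * \<i>"
        using assms(1) by (simp add: field_simps)
      then have "e (int j - int n) = e (int j)"
        unfolding e_def by (metis exp_diff exp_two_pi_i div_by_1)
      then show ?thesis using that[of "int j - int n"] ej False j(1) by simp
    qed
    let ?x = "pi * \<bar>real_of_int i\<bar> / real n"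
    have "2 * \<bar>real_of_int i\<bar> \<le> real n" using i(2) by linarith
    then have x: "0 \<le> ?x" "?x \<le> pi / 2" using assms(1) by (auto simp: field_simps)
    have "cmod (\<omega> - 1) = 2 * \<bar>sin (pi * real_of_int i / real n)\<bar>"
      unfolding i(1) e_def dist_exp_i_1 by simp
    also have "\<bar>sin (pi * real_of_int i / real n)\<bar> = \<bar>sin ?x\<bar>"
      by (cases "i \<ge> 0") auto
    also have "\<bar>real_of_int i\<bar> / real n \<le> 2 * \<bar>sin ?x\<bar>"
    proof -
      have "?x / pi = \<bar>real_of_int i\<bar> / real n" by simp
      then show ?thesis using sin_ge_linear[OF x] by linarith
    qed
    finally have "\<bar>real_of_int i\<bar> / real n \<le> \<sigma>" using \<omega>(2) by linarith
    then have "real_of_int \<bar>i\<bar> \<le> \<sigma> * real n" using assms(1) by (simp add: field_simps)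
    then have "\<bar>i\<bar> \<le> B" unfolding B_def by (simp only: le_floor_iff)
    then have "i \<in> {-B..B}" by auto
    then show "\<omega> \<in> e ` {-B..B}" unfolding i(1) by (rule imageI)
  qed
  then have "card {\<omega>::complex. \<omega> ^ n = 1 \<and> cmod (\<omega> - 1) \<le> \<sigma>} \<le> card {-B..B}"
    by (meson card_image_le card_mono finite_atLeastAtMost_int finite_imageI order_trans)
  also have "card {-B..B} = nat (2 * B + 1)" by simp
  finally have "real (card {\<omega>::complex. \<omega> ^ n = 1 \<and> cmod (\<omega> - 1) \<le> \<sigma>})
      \<le> 2 * real_of_int B + 1"
    using B by linarith
  also have "\<dots> \<le> 2 * \<sigma> * real n + 1"
    unfolding B_def using of_int_floor_le[of "\<sigma> * real n"] by simp
  finally show ?thesis .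
qed


section \<open>The Cantor sets\<close>

text \<open>The first degree is exempt from the bound \<open>c_le\<close>, which makes each inverse branch of a later block
  map the disc of radius 2 into itself: nothing constrains the starting point, and a truncated first
  block may have degree as small as 2. The growth of \<open>c\<close> yields thinness, that of \<open>d\<close> dimension 1.\<close>

locale cantor =
  fixes d :: "nat \<Rightarrow> nat" and c :: "nat \<Rightarrow> real"
  assumes d_ge: "2 \<le> d k"
    and c_ge: "16 \<le> c k"
    and c_le: "0 < k \<Longrightarrow> c k + 2 \<le> 2 ^ d k"
    and c_growth: "64 ^ k \<le> c k"
    and d_growth: "0 < s \<Longrightarrow> s < 1 \<Longrightarrow> \<exists>n. \<forall>k\<ge>n. (c k + 2) powr s \<le> real (d k) powr (1 - s)"
begin

primrec F :: "nat \<Rightarrow> complex \<Rightarrow> complex" where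
  "F 0 z = z"
| "F (Suc k) z = F k z ^ d k + of_real (c k)"

definition T :: "nat \<Rightarrow> complex set" where
  "T n = {z. \<forall>k<n. cmod (F (Suc k) z) \<le> 2}"

definition E :: "complex set" where
  "E = {z. \<forall>k. cmod (F (Suc k) z) \<le> 2}"

lemma T_F: "z \<in> T n \<Longrightarrow> k < n \<Longrightarrow> cmod (F (Suc k) z) \<le> 2"
  by (simp add: T_def)

lemma T_antimono: "m \<le> n \<Longrightarrow> T n \<subseteq> T m"
  by (auto simp: T_def)

lemma E_subset_T: "E \<subseteq> T n"
  by (auto simp: E_def T_def)

lemma d_pos: "0 < d k" using d_ge[of k] by simp

lemma c_pos: "0 < c k" using c_ge[of k] by simp

lemma F_power_bounds:
  assumes "z \<in> T n" "k < n"
  shows "c k - 2 \<le> cmod (F k z) ^ d k" "cmod (F k z) ^ d k \<le> c k + 2"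
proof -
  have "F k z ^ d k = F (Suc k) z - of_real (c k)" by simp
  then have eq: "cmod (F k z) ^ d k = cmod (F (Suc k) z - of_real (c k))"
    by (metis norm_power)
  show "c k - 2 \<le> cmod (F k z) ^ d k"
    using norm_triangle_ineq2[of "of_real (c k)" "F (Suc k) z"] T_F[OF assms] c_pos[of k]
    unfolding eq by (simp add: norm_minus_commute)
  show "cmod (F k z) ^ d k \<le> c k + 2"
    using norm_triangle_ineq4[of "F (Suc k) z" "of_real (c k)"] T_F[OF assms] c_pos[of k]
    unfolding eq by simp
qed

lemma F_ge_1: "z \<in> T n \<Longrightarrow> k < n \<Longrightarrow> 1 \<le> cmod (F k z)"
  using F_power_bounds(1)[of z n k] c_ge[of k] power_le_one[of "cmod (F k z)" "d k"]
  by (smt (verit) norm_ge_zero)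

lemma continuous_F: "continuous_on UNIV (F k)"
  by (induction k) (auto intro!: continuous_intros)

lemma compact_T:
  assumes "0 < n"
  shows "compact (T n)"
proof -
  have "closed (T n)"
  proof -
    have "T n = (\<Inter>k<n. {z. cmod (F (Suc k) z) \<le> 2})" by (auto simp: T_def)
    moreover have "closed {z. cmod (F k z) \<le> 2}" for k
      by (intro closed_Collect_le continuous_on_norm continuous_F continuous_on_const)
    ultimately show ?thesis by (auto simp del: F.simps)
  qed
  moreover have "T n \<subseteq> cball 0 (c 0 + 2)"
  proof
    fix z assume z: "z \<in> T n"
    have "cmod z \<le> cmod z ^ d 0"
      using F_ge_1[OF z assms] d_pos[of 0] by (simp add: self_le_power)
    then show "z \<in> cball 0 (c 0 + 2)" using F_power_bounds(2)[OF z assms] by simp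
  qed
  ultimately show ?thesis
    using bounded_cball bounded_subset compact_eq_bounded_closed by blast
qed

lemma compact_E: "compact E"
proof -
  have "E = T 1 \<inter> (\<Inter>n\<in>{0<..}. T n)"
    unfolding E_def T_def by (auto simp del: F.simps)
  moreover have "closed (\<Inter>n\<in>{0<..}. T n)"
    using compact_T compact_imp_closed by auto
  ultimately show ?thesis using compact_Int_closed[OF compact_T[of 1]] by simp
qed

subsection \<open>Expansion\<close>

lemma F_Suc_expansion_le:
  assumes "x \<in> T n" "y \<in> T n" "k < n"
  shows "cmod (F (Suc k) x - F (Suc k) y) \<le> d k * (c k + 2) * cmod (F k x - F k y)"
proof -
  define R where "R = max (cmod (F k x)) (cmod (F k y))"
  have "R ^ (d k - 1) \<le> R ^ d k"
    using F_ge_1[OF assms(1,3)] unfolding R_def by (intro power_increasing) auto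
  also have "\<dots> \<le> c k + 2"
    using F_power_bounds(2)[of _ n k] assms unfolding R_def max_def by auto
  finally have "real (d k) * R ^ (d k - 1) * cmod (F k x - F k y)
      \<le> d k * (c k + 2) * cmod (F k x - F k y)"
    by (intro mult_right_mono mult_left_mono) auto
  then show ?thesis
    using norm_power_diff_le[of "F k x" R "F k y" "d k"] unfolding R_def by simp
qed

definition \<Lambda> :: "nat \<Rightarrow> real" where
  "\<Lambda> n = (\<Prod>k<n. d k * (c k + 2))"

lemma \<Lambda>_pos: "0 < \<Lambda> n"
  unfolding \<Lambda>_def using d_pos c_pos by (intro prod_pos) (auto intro!: mult_pos_pos add_pos_pos)

lemma F_expansion_le:
  assumes "x \<in> T n" "y \<in> T n"
  shows "k \<le> n \<Longrightarrow> cmod (F k x - F k y) \<le> \<Lambda> k * cmod (x - y)"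
proof (induction k)
  case (Suc k)
  have "cmod (F (Suc k) x - F (Suc k) y) \<le> d k * (c k + 2) * cmod (F k x - F k y)"
    by (rule F_Suc_expansion_le[OF assms]) (use Suc in simp)
  also have "\<dots> \<le> d k * (c k + 2) * (\<Lambda> k * cmod (x - y))"
    using Suc c_pos[of k] by (intro mult_left_mono) auto
  also have "\<dots> = \<Lambda> (Suc k) * cmod (x - y)" by (simp add: \<Lambda>_def mult_ac)
  finally show ?case .
qed (simp add: \<Lambda>_def)

subsection \<open>Inverse branches\<close>

text \<open>The power \<open>(1 - w / c) ^ (1 / d)\<close> with the principal branch, so that \<open>w \<mapsto> \<zeta> * h w\<close> for the roots \<open>\<zeta>\<close> of
  \<open>\<zeta> ^ d = - c\<close> are the inverse branches of the block map on the disc of radius 2.\<close>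

definition h :: "nat \<Rightarrow> complex \<Rightarrow> complex" where
  "h k w = exp (Ln (1 - w / of_real (c k)) / of_nat (d k))"

lemma Re_branch_pos:
  assumes "cmod w \<le> 2"
  shows "0 < Re (1 - w / of_real (c k))"
proof -
  have "Re w \<le> 2" using assms complex_Re_le_cmod[of w] by linarith
  then have "Re w / c k < 1" using c_ge[of k] by (simp add: field_simps)
  then show ?thesis by simp
qed

lemma h_power:
  assumes "cmod w \<le> 2"
  shows "h k w ^ d k = 1 - w / of_real (c k)"
proof -
  have "1 - w / of_real (c k) \<noteq> 0" using Re_branch_pos[OF assms, of k] by force
  then show ?thesis
    unfolding h_def exp_of_nat_mult[symmetric] using d_pos[of k] by simp
qed

lemma h_0: "h k 0 = 1"
  by (simp add: h_def)

lemma h_bounds: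
  assumes "cmod w \<le> 2"
  shows "7 / 8 \<le> cmod (h k w)" "cmod (h k w) \<le> 9 / 8"
proof -
  have small: "cmod (w / of_real (c k)) \<le> 1 / 8"
    using assms c_ge[of k] by (simp add: norm_divide field_simps)
  have eq: "cmod (h k w) ^ d k = cmod (1 - w / of_real (c k))"
    using h_power[OF assms] by (metis norm_power)
  have low: "7 / 8 \<le> cmod (h k w) ^ d k"
    using norm_triangle_ineq2[of 1 "w / of_real (c k)"] small unfolding eq norm_one by linarith
  have up: "cmod (h k w) ^ d k \<le> 9 / 8"
    using norm_triangle_ineq4[of 1 "w / of_real (c k)"] small unfolding eq norm_one by linarith
  show "7 / 8 \<le> cmod (h k w)"
    using low power_decreasing[of 1 "d k" "cmod (h k w)"] d_pos[of k]
    by (cases "cmod (h k w) \<le> 1") auto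
  show "cmod (h k w) \<le> 9 / 8"
    using up self_le_power[of "cmod (h k w)" "d k"] d_pos[of k]
    by (cases "cmod (h k w) \<le> 1") auto
qed

lemma h_lipschitz:
  assumes "cmod v \<le> 2" "cmod w \<le> 2"
  shows "cmod (h k v - h k w) \<le> 2 / (d k * (c k - 2)) * cmod (v - w)"
proof (rule field_differentiable_bound[where S="cball 0 2"])
  fix z :: complex assume "z \<in> cball 0 2"
  then have z: "cmod z \<le> 2" by simp
  let ?u = "1 - z / of_real (c k)"
  have nonpos: "?u \<notin> \<real>\<^sub>\<le>\<^sub>0"
    using Re_branch_pos[OF z, of k] by (auto simp: complex_nonpos_Reals_iff)
  have u0: "?u \<noteq> 0" using nonpos by auto
  have c0: "complex_of_real (c k) \<noteq> 0" using c_pos[of k] by simp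
  have "((\<lambda>z. 1 - z / of_real (c k)) has_field_derivative - 1 / of_real (c k)) (at z)"
    using DERIV_diff[OF DERIV_const DERIV_cdivide[OF DERIV_ident]] by simp
  then have "((\<lambda>z. Ln (1 - z / of_real (c k))) has_field_derivative
      inverse ?u * (- 1 / of_real (c k))) (at z)"
    by (rule DERIV_chain2[where f=Ln and g="\<lambda>z. 1 - z / of_real (c k)",
          OF has_field_derivative_Ln[OF nonpos]])
  then have "(h k has_field_derivative
      exp (Ln ?u / of_nat (d k)) * (inverse ?u * (- 1 / of_real (c k)) / of_nat (d k))) (at z)"
    unfolding h_def[abs_def]
    by (intro DERIV_chain2[where f=exp, OF DERIV_exp] DERIV_cdivide)
  moreover have "exp (Ln ?u / of_nat (d k)) * (inverse ?u * (- 1 / of_real (c k)) / of_nat (d k))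
      = h k z * (- 1 / (of_real (c k) * ?u)) / of_nat (d k)"
    by (simp add: h_def divide_inverse mult_ac)
  ultimately show "(h k has_field_derivative (h k z * (- 1 / (of_real (c k) * ?u)) / of_nat (d k)))
      (at z within cball 0 2)"
    by (simp add: has_field_derivative_at_within)
  have cu: "of_real (c k) * ?u = of_real (c k) - z" using c0 by (simp add: field_simps)
  have "c k - 2 \<le> cmod (of_real (c k) - z)"
    using norm_triangle_ineq2[of "of_real (c k)" z] z c_pos[of k] by simp
  then have "cmod (h k z) / cmod (of_real (c k) - z) \<le> 2 / (c k - 2)"
    using h_bounds(2)[OF z, of k] c_ge[of k] by (intro frac_le) auto
  then have "cmod (h k z) / cmod (of_real (c k) - z) / real (d k) \<le> 2 / (c k - 2) / real (d k)"
    by (rule divide_right_mono) simp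
  then show "cmod (h k z * (- 1 / (of_real (c k) * ?u)) / of_nat (d k)) \<le> 2 / (d k * (c k - 2))"
    unfolding cu by (simp add: norm_mult norm_divide mult.commute)
qed (use assms in auto)

definition Z :: "nat \<Rightarrow> complex set" where
  "Z k = {\<zeta>. \<zeta> ^ d k = - of_real (c k)}"

text \<open>The root that selects the inverse branch taken at stage \<open>k\<close>.\<close>

definition rt :: "nat \<Rightarrow> complex \<Rightarrow> complex" where
  "rt k z = F k z / h k (F (Suc k) z)"

lemma h_nonzero: "h k w \<noteq> 0"
  by (simp add: h_def)

lemma F_eq_rt: "F k z = rt k z * h k (F (Suc k) z)"
  using h_nonzero by (simp add: rt_def)

lemma rt_in_Z:
  assumes "z \<in> T n" "k < n"
  shows "rt k z \<in> Z k"
proof -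
  have "rt k z ^ d k = (F (Suc k) z - of_real (c k)) / (1 - F (Suc k) z / of_real (c k))"
    unfolding rt_def power_divide h_power[OF T_F[OF assms]] by simp
  moreover have "1 - F (Suc k) z / of_real (c k) \<noteq> 0"
    using Re_branch_pos[OF T_F[OF assms], of k] by (metis less_irrefl zero_complex.sel(1))
  moreover have "F (Suc k) z - of_real (c k) = - of_real (c k) * (1 - F (Suc k) z / of_real (c k))"
    using c_pos[of k] by (simp add: right_diff_distrib del: F.simps)
  ultimately show ?thesis unfolding Z_def by (simp del: F.simps)
qed

lemma card_Z: "card (Z k) = d k"
  unfolding Z_def using c_pos[of k] d_pos[of k] by (intro card_nth_roots) auto

lemma finite_Z: "finite (Z k)"
  using card_Z[of k] d_pos[of k] by (intro card_ge_0_finite) simp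

lemma Z_norm_power: "\<zeta> \<in> Z k \<Longrightarrow> cmod \<zeta> ^ d k = c k"
  unfolding Z_def using c_pos[of k] by (auto simp flip: norm_power)

lemma Z_norm_eq: "\<zeta> \<in> Z k \<Longrightarrow> \<xi> \<in> Z k \<Longrightarrow> cmod \<zeta> = cmod \<xi>"
  using Z_norm_power[of \<zeta> k] Z_norm_power[of \<xi> k] d_pos[of k]
  by (metis norm_ge_zero power_eq_imp_eq_base)

lemma Z_norm_ge: "\<zeta> \<in> Z k \<Longrightarrow> 1 \<le> cmod \<zeta>"
  using Z_norm_power[of \<zeta> k] c_ge[of k] power_le_one[of "cmod \<zeta>" "d k"]
  by (smt (verit) norm_ge_zero)

text \<open>A bound for the modulus \<open>c ^ (1 / d)\<close> of the roots; \<open>c_le\<close> gives 2, but says nothing about stage 0.\<close>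

definition \<rho> :: "nat \<Rightarrow> real" where
  "\<rho> k = (if k = 0 then c 0 else 2)"

lemma Z_norm_le:
  assumes "\<zeta> \<in> Z k"
  shows "cmod \<zeta> \<le> \<rho> k"
proof (cases "k = 0")
  case True
  then show ?thesis
    using self_le_power[OF Z_norm_ge[OF assms] d_pos[of k]] Z_norm_power[OF assms]
    by (simp add: \<rho>_def)
next
  case False
  have "cmod \<zeta> ^ d k \<le> 2 ^ d k" using Z_norm_power[OF assms] c_le[of k] False by simp
  then have "cmod \<zeta> \<le> 2" using power_mono_iff[of "cmod \<zeta>" 2 "d k"] d_pos[of k] by simp
  then show ?thesis using False by (simp add: \<rho>_def)
qed

lemma \<rho>_pos: "0 < \<rho> k" using c_pos[of 0] by (simp add: \<rho>_def)

definition \<mu> :: "nat \<Rightarrow> real" where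
  "\<mu> k = 2 * \<rho> k / (d k * (c k - 2))"

lemma \<mu>_pos: "0 < \<mu> k"
  unfolding \<mu>_def using \<rho>_pos[of k] d_pos[of k] c_ge[of k] by (intro divide_pos_pos mult_pos_pos) auto

text \<open>Two points with the same root lie in the image of one inverse branch, whose derivative is small.\<close>

lemma same_root_contraction:
  assumes "x \<in> T n" "y \<in> T n" "k < n" "rt k x = rt k y"
  shows "cmod (F k x - F k y) \<le> \<mu> k * cmod (F (Suc k) x - F (Suc k) y)"
proof -
  have "cmod (F k x - F k y) = cmod (rt k x) * cmod (h k (F (Suc k) x) - h k (F (Suc k) y))"
    unfolding F_eq_rt[of k x] F_eq_rt[of k y] assms(4) by (simp flip: norm_mult right_diff_distrib del: F.simps)
  also have "\<dots> \<le> \<rho> k * (2 / (d k * (c k - 2)) * cmod (F (Suc k) x - F (Suc k) y))"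
    using Z_norm_le[OF rt_in_Z[OF assms(1,3)]] \<rho>_pos[of k]
      h_lipschitz[OF T_F[OF assms(1,3)] T_F[OF assms(2,3)], of k]
    by (intro mult_mono) (auto simp del: F.simps)
  finally show ?thesis by (simp add: \<mu>_def mult_ac del: F.simps)
qed

text \<open>The roots themselves are at least \<open>2 / d\<close> apart. Moving \<open>F k x\<close> along its own branch to
  the value \<open>F (Suc k) y\<close> costs at most the diameter of a piece, which is smaller by a factor of order
  \<open>c\<close>, and the points of two branches over one value are almost as far apart as the roots.\<close>

lemma different_roots_separated:
  assumes "x \<in> T n" "y \<in> T n" "k < n" "rt k x \<noteq> rt k y"
  shows "1 / d k \<le> cmod (F k x - F k y)"
proof -
  define a b where "a = F (Suc k) x" and "b = F (Suc k) y"
  define \<zeta> \<xi> where "\<zeta> = rt k x" and "\<xi> = rt k y"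
  have ab: "cmod a \<le> 2" "cmod b \<le> 2" unfolding a_def b_def using assms T_F by blast+
  have Z: "\<zeta> \<in> Z k" "\<xi> \<in> Z k" unfolding \<zeta>_def \<xi>_def using assms rt_in_Z by blast+
  have \<zeta>1: "1 \<le> cmod \<zeta>" by (rule Z_norm_ge[OF Z(1)])
  then have \<zeta>0: "\<zeta> \<noteq> 0" by auto
  have d0: "0 < real (d k)" using d_pos[of k] by simp
  have "(\<xi> / \<zeta>) ^ d k = 1"
    using Z \<zeta>0 c_pos[of k] by (simp add: Z_def power_divide)
  moreover have "\<xi> / \<zeta> \<noteq> 1" using assms(4) \<zeta>0 by (simp add: \<zeta>_def \<xi>_def)
  ultimately have "2 / d k \<le> cmod (1 - \<xi> / \<zeta>)"
    using d_pos[of k] by (rule root_of_unity_dist_1)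
  then have "cmod \<zeta> * (2 / d k) \<le> cmod \<zeta> * cmod (1 - \<xi> / \<zeta>)" by (intro mult_left_mono) auto
  also have "\<dots> = cmod (\<zeta> - \<xi>)" using \<zeta>0 by (simp flip: norm_mult add: right_diff_distrib)
  finally have sep: "cmod \<zeta> * (2 / d k) \<le> cmod (\<zeta> - \<xi>)" .
  have "cmod \<zeta> * (2 / d k) * (7 / 8) \<le> cmod (\<zeta> - \<xi>) * cmod (h k b)"
    using sep h_bounds(1)[OF ab(2), of k] \<zeta>1 d0 by (intro mult_mono) auto
  moreover have "cmod (\<zeta> * h k a - \<zeta> * h k b) \<le> cmod \<zeta> * (1 / d k * (4 / 7))"
  proof -
    have "cmod (h k a - h k b) \<le> 2 / (d k * (c k - 2)) * cmod (a - b)"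
      by (rule h_lipschitz[OF ab])
    also have "\<dots> \<le> 2 / (d k * 14) * 4"
      using c_ge[of k] d0 norm_triangle_ineq4[of a b] ab
      by (intro mult_mono divide_left_mono mult_left_mono mult_pos_pos) auto
    finally have "cmod (h k a - h k b) \<le> 1 / d k * (4 / 7)" by simp
    then show ?thesis
      unfolding right_diff_distrib[symmetric] norm_mult by (intro mult_left_mono) auto
  qed
  moreover have "cmod (\<zeta> - \<xi>) * cmod (h k b)
      \<le> cmod (F k x - F k y) + cmod (\<zeta> * h k a - \<zeta> * h k b)"
  proof -
    have "(\<zeta> - \<xi>) * h k b = (F k x - F k y) - (\<zeta> * h k a - \<zeta> * h k b)"
      unfolding F_eq_rt[of k x] F_eq_rt[of k y] \<zeta>_def \<xi>_def a_def b_def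
      by (simp add: algebra_simps del: F.simps)
    then show ?thesis by (metis norm_mult norm_triangle_ineq4)
  qed
  ultimately have "cmod \<zeta> * (2 / d k) * (7 / 8) - cmod \<zeta> * (1 / d k * (4 / 7)) \<le> cmod (F k x - F k y)"
    by linarith
  moreover have "cmod \<zeta> * (2 / d k) * (7 / 8) - cmod \<zeta> * (1 / d k * (4 / 7)) = cmod \<zeta> * (33 / 28) / d k"
    using d0 by (simp add: field_simps)
  moreover have "1 / d k \<le> cmod \<zeta> * (33 / 28) / d k"
    using \<zeta>1 d0 by (intro divide_right_mono) auto
  ultimately show ?thesis by linarith
qed

text \<open>Each point is within \<open>O(1 / d)\<close> of its root, relative to the radius of the circle of roots; after
  division by one of the roots the count is one of roots of unity near 1.\<close>

lemma card_roots_le: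
  assumes "V \<subseteq> T n" "k < n" "0 \<le> \<tau>"
    and \<tau>: "\<And>x y. x \<in> V \<Longrightarrow> y \<in> V \<Longrightarrow> cmod (F k x - F k y) \<le> \<tau>"
  shows "real (card (rt k ` V)) \<le> 2 * real (d k) * \<tau> + 3"
proof (cases "V = {}")
  case False
  then obtain y where y: "y \<in> V" by blast
  have d0: "0 < real (d k)" using d_pos[of k] by simp
  define \<xi> where "\<xi> = rt k y"
  define \<sigma> where "\<sigma> = \<tau> + 1 / d k"
  have \<sigma>0: "0 \<le> \<sigma>" using assms(3) d0 by (simp add: \<sigma>_def)
  let ?W = "{\<omega>::complex. \<omega> ^ d k = 1 \<and> cmod (\<omega> - 1) \<le> \<sigma>}"
  have near: "cmod (rt k x - F k x) \<le> cmod (rt k x) * (1 / d k * (2 / 7))" if "x \<in> V" for x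
  proof -
    have a: "cmod (F (Suc k) x) \<le> 2" using that assms T_F by blast
    have "rt k x - F k x = rt k x * (h k 0 - h k (F (Suc k) x))"
      using F_eq_rt[of k x] by (simp add: h_0 right_diff_distrib del: F.simps)
    then have "cmod (rt k x - F k x) = cmod (rt k x) * cmod (h k 0 - h k (F (Suc k) x))"
      by (metis norm_mult)
    also have "cmod (h k 0 - h k (F (Suc k) x)) \<le> 2 / (d k * (c k - 2)) * cmod (0 - F (Suc k) x)"
      by (rule h_lipschitz) (use a in auto)
    also have "\<dots> \<le> 2 / (d k * 14) * 2"
      using c_ge[of k] d0 a
      by (intro mult_mono divide_left_mono mult_left_mono mult_pos_pos) (auto simp del: F.simps)
    finally show ?thesis by (simp add: mult_left_mono)
  qed
  have "rt k ` V \<subseteq> (\<lambda>\<omega>. \<omega> * \<xi>) ` ?W"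
  proof
    fix \<zeta> assume "\<zeta> \<in> rt k ` V"
    then obtain x where x: "x \<in> V" "\<zeta> = rt k x" by blast
    have Z: "\<zeta> \<in> Z k" "\<xi> \<in> Z k" unfolding x(2) \<xi>_def using x y assms rt_in_Z by blast+
    have \<xi>1: "1 \<le> cmod \<xi>" by (rule Z_norm_ge[OF Z(2)])
    then have \<xi>0: "\<xi> \<noteq> 0" by auto
    have "cmod (\<zeta> - \<xi>) \<le> cmod (\<zeta> - F k x) + cmod (F k x - F k y) + cmod (\<xi> - F k y)"
      using norm_triangle_ineq[of "\<zeta> - F k x + (F k x - F k y)" "F k y - \<xi>"]
        norm_triangle_ineq[of "\<zeta> - F k x" "F k x - F k y"]
      by (simp add: norm_minus_commute)
    also have "\<dots> \<le> cmod \<xi> * (1 / d k * (2 / 7)) + cmod \<xi> * \<tau> + cmod \<xi> * (1 / d k * (2 / 7))"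
    proof (intro add_mono)
      show "cmod (\<zeta> - F k x) \<le> cmod \<xi> * (1 / d k * (2 / 7))"
        using near[OF x(1)] Z_norm_eq[OF Z] by (simp add: x(2))
      show "cmod (F k x - F k y) \<le> cmod \<xi> * \<tau>"
        using \<tau>[OF x(1) y] mult_right_mono[OF \<xi>1, of \<tau>] assms(3) by simp
      show "cmod (\<xi> - F k y) \<le> cmod \<xi> * (1 / d k * (2 / 7))"
        using near[OF y] by (simp add: \<xi>_def)
    qed
    also have "\<dots> = cmod \<xi> * (\<tau> + 4 / 7 * (1 / d k))" by (simp add: algebra_simps)
    also have "\<dots> \<le> cmod \<xi> * \<sigma>"
      unfolding \<sigma>_def using d0 by (intro mult_left_mono add_mono) (auto simp: field_simps)
    finally have "cmod (\<zeta> - \<xi>) \<le> cmod \<xi> * \<sigma>" .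
    moreover have "\<zeta> / \<xi> - 1 = (\<zeta> - \<xi>) / \<xi>" using \<xi>0 by (simp add: diff_divide_distrib)
    ultimately have "cmod (\<zeta> / \<xi> - 1) \<le> \<sigma>"
      using \<xi>1 \<xi>0 by (simp add: norm_divide divide_le_eq mult.commute)
    moreover have "(\<zeta> / \<xi>) ^ d k = 1"
      using Z \<xi>0 c_pos[of k] by (simp add: Z_def power_divide)
    ultimately show "\<zeta> \<in> (\<lambda>\<omega>. \<omega> * \<xi>) ` ?W"
      using \<xi>0 by (intro image_eqI[of _ _ "\<zeta> / \<xi>"]) auto
  qed
  moreover have "finite ?W" using finite_nth_roots[OF d_pos, of k 1] by (rule rev_finite_subset) auto
  ultimately have "card (rt k ` V) \<le> card ?W"
    by (meson card_image_le card_mono finite_imageI order_trans)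
  then have "real (card (rt k ` V)) \<le> 2 * \<sigma> * d k + 1"
    using card_roots_of_unity_near_1[OF d_pos[of k] \<sigma>0] by linarith
  also have "\<dots> = 2 * real (d k) * \<tau> + 3" using d0 by (simp add: \<sigma>_def field_simps)
  finally show ?thesis .
qed (use assms in simp)

subsection \<open>Itineraries\<close>

definition code :: "nat \<Rightarrow> complex \<Rightarrow> nat \<Rightarrow> complex" where
  "code n z = restrict (\<lambda>k. rt k z) {..<n}"

definition N :: "nat \<Rightarrow> real" where
  "N n = (\<Prod>k<n. real (d k))"

lemma N_pos: "0 < N n"
  unfolding N_def using d_pos by (intro prod_pos) auto

lemma N_ge_1: "1 \<le> N n"
  unfolding N_def using d_pos by (intro prod_ge_1) (auto simp: Suc_le_eq)

lemma code_in_PiE: "z \<in> T n \<Longrightarrow> code n z \<in> PiE {..<n} Z"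
  using rt_in_Z by (auto simp: code_def)

lemma finite_codes: "finite (PiE {..<n} Z)"
  by (intro finite_PiE) (auto simp: finite_Z)

lemma card_codes: "real (card (PiE {..<n} Z)) = N n"
  by (simp add: card_PiE card_Z N_def)

text \<open>Composing the inverse branches prescribed by \<open>\<phi>\<close>. Their images stay in the disc of radius 2 except
  possibly at the start, where no such condition is imposed.\<close>

lemma ex_itinerary:
  assumes "\<And>k. k < n \<Longrightarrow> \<phi> k \<in> Z k" and "cmod w \<le> 2"
  shows "\<exists>z\<in>T n. F n z = w \<and> (\<forall>k<n. rt k z = \<phi> k)"
  using assms
proof (induction n arbitrary: w)
  case 0
  then show ?case by (auto simp: T_def)
next
  case (Suc n)
  define w' where "w' = \<phi> n * h n w"
  have Z: "\<phi> n \<in> Z n" using Suc.prems(1) by simp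
  have w'_power: "w' ^ d n + of_real (c n) = w"
    using Z c_pos[of n]
    unfolding w'_def power_mult_distrib h_power[OF Suc.prems(2)] by (simp add: Z_def field_simps)
  have "\<exists>z\<in>T n. F n z = w' \<and> (\<forall>k<n. rt k z = \<phi> k)"
  proof (cases "n = 0")
    case False
    have "cmod w' ^ d n = cmod (w - of_real (c n))"
      using w'_power by (metis add_diff_cancel_right' norm_power)
    also have "\<dots> \<le> c n + 2"
      using norm_triangle_ineq4[of w "of_real (c n)"] Suc.prems(2) c_pos[of n] by simp
    also have "\<dots> \<le> 2 ^ d n" using c_le False by simp
    finally have "cmod w' \<le> 2" using power_mono_iff[of "cmod w'" 2 "d n"] d_pos[of n] by simp
    then show ?thesis using Suc by simp
  qed (auto simp: T_def)
  then obtain z where z: "z \<in> T n" "F n z = w'" "\<forall>k<n. rt k z = \<phi> k" by blast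
  have Fw: "F (Suc n) z = w" using z(2) w'_power by simp
  then have "z \<in> T (Suc n)"
    using z(1) Suc.prems(2) by (auto simp: T_def less_Suc_eq simp del: F.simps)
  moreover have "rt n z = \<phi> n"
    unfolding rt_def Fw z(2) w'_def using h_nonzero by simp
  ultimately show ?case using z(3) Fw by (auto simp: less_Suc_eq simp del: F.simps)
qed

lemma code_onto: "PiE {..<n} Z \<subseteq> code n ` T n"
proof
  fix \<phi> assume \<phi>: "\<phi> \<in> PiE {..<n} Z"
  obtain z where z: "z \<in> T n" "\<forall>k<n. rt k z = \<phi> k"
    using ex_itinerary[of n \<phi> 0] \<phi> by (auto simp: PiE_iff)
  have "code n z = \<phi>"
    using \<phi> z(2) by (auto simp: code_def PiE_iff extensional_def fun_eq_iff)
  then show "\<phi> \<in> code n ` T n" using z(1) by blast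
qed

definition \<Delta> :: "nat \<Rightarrow> real" where
  "\<Delta> n = (\<Prod>k<n. \<mu> k)"

lemma \<Delta>_pos: "0 < \<Delta> n"
  unfolding \<Delta>_def using \<mu>_pos by (intro prod_pos) auto

lemma same_code_dist_le:
  assumes "x \<in> T n" "y \<in> T n" and eq: "\<And>k. k < n \<Longrightarrow> rt k x = rt k y" and "0 < n"
  shows "cmod (x - y) \<le> 4 * \<Delta> n"
proof -
  have "cmod (x - y) \<le> \<Delta> k * cmod (F k x - F k y)" if "k \<le> n" for k
    using that
  proof (induction k)
    case (Suc k)
    have "cmod (x - y) \<le> \<Delta> k * cmod (F k x - F k y)" using Suc by simp
    also have "\<dots> \<le> \<Delta> k * (\<mu> k * cmod (F (Suc k) x - F (Suc k) y))"
      using Suc.prems \<Delta>_pos[of k]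
      by (intro mult_left_mono same_root_contraction[OF assms(1,2)] eq) auto
    finally show ?case by (simp add: \<Delta>_def mult_ac del: F.simps)
  qed (simp add: \<Delta>_def)
  from this[of n] have "cmod (x - y) \<le> \<Delta> n * cmod (F n x - F n y)" by simp
  also have "cmod (F n x - F n y) \<le> 4"
  proof -
    obtain m where m: "n = Suc m" using assms(4) gr0_implies_Suc by blast
    have "cmod (F n x) \<le> 2" "cmod (F n y) \<le> 2"
      using assms T_F[of _ n m] unfolding m by blast+
    then show ?thesis using norm_triangle_ineq4[of "F n x" "F n y"] by linarith
  qed
  finally show ?thesis using \<Delta>_pos[of n] by (simp add: mult.commute mult_left_mono)
qed

text \<open>The scale of stage \<open>n\<close>: points whose roots differ there are at least this far apart.\<close>

definition \<delta> :: "nat \<Rightarrow> real" where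
  "\<delta> n = 1 / (\<Lambda> n * d n)"

lemma \<delta>_pos: "0 < \<delta> n"
  unfolding \<delta>_def using \<Lambda>_pos[of n] d_pos[of n] by simp

lemma different_code_dist_ge:
  assumes "x \<in> T n" "y \<in> T n" "k < n" "rt k x \<noteq> rt k y"
  shows "\<delta> k \<le> cmod (x - y)"
proof -
  have "1 / d k \<le> \<Lambda> k * cmod (x - y)"
    using different_roots_separated[OF assms] F_expansion_le[OF assms(1,2), of k] assms(3)
    by linarith
  then show ?thesis
    unfolding \<delta>_def using \<Lambda>_pos[of k] d_pos[of k] by (simp add: field_simps)
qed

lemma \<delta>_Suc: "\<delta> (Suc n) \<le> \<delta> n / 2"
proof -
  have "2 * (\<Lambda> n * d n) \<le> (c n + 2) * d (Suc n) * (\<Lambda> n * d n)"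
  proof (rule mult_right_mono)
    have "1 * 2 \<le> (c n + 2) * real (d (Suc n))"
      using c_ge[of n] d_ge[of "Suc n"] by (intro mult_mono) auto
    then show "2 \<le> (c n + 2) * real (d (Suc n))" by simp
  qed (use \<Lambda>_pos[of n] in simp)
  then have "1 / ((c n + 2) * d (Suc n) * (\<Lambda> n * d n)) \<le> 1 / (2 * (\<Lambda> n * d n))"
    using \<Lambda>_pos[of n] d_pos[of n] d_pos[of "Suc n"] c_pos[of n]
    by (intro divide_left_mono mult_pos_pos) auto
  moreover have "\<delta> (Suc n) = 1 / ((c n + 2) * d (Suc n) * (\<Lambda> n * d n))"
    unfolding \<delta>_def by (simp add: \<Lambda>_def mult_ac)
  ultimately show ?thesis unfolding \<delta>_def by (simp add: field_simps)
qed

lemma \<delta>_tendsto_0: "\<delta> \<longlonglongrightarrow> 0"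
proof (rule tendsto_sandwich[where f="\<lambda>_. 0" and h="\<lambda>n. \<delta> 0 * (1 / 2) ^ n"])
  have "\<delta> n \<le> \<delta> 0 * (1 / 2) ^ n" for n
  proof (induction n)
    case (Suc n)
    then show ?case using \<delta>_Suc[of n] by simp
  qed simp
  then show "\<forall>\<^sub>F n in sequentially. \<delta> n \<le> \<delta> 0 * (1 / 2) ^ n" by simp
  show "(\<lambda>n. \<delta> 0 * (1 / 2) ^ n) \<longlonglongrightarrow> 0"
    by (intro tendsto_mult_right_zero LIMSEQ_power_zero) simp
qed (use \<delta>_pos in \<open>auto intro!: always_eventually less_imp_le\<close>)

lemma \<delta>_antimono: "decseq \<delta>"
proof (rule decseq_SucI)
  show "\<delta> (Suc n) \<le> \<delta> n" for n using \<delta>_Suc[of n] \<delta>_pos[of n] by linarith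
qed

subsection \<open>Hausdorff dimension\<close>

lemma N_\<Delta>_Suc: "0 < n \<Longrightarrow> N (Suc n) * \<Delta> (Suc n) \<le> N n * \<Delta> n / 2"
proof -
  assume "0 < n"
  then have "d n * \<mu> n = 4 / (c n - 2)"
    unfolding \<mu>_def \<rho>_def using d_pos[of n] by simp
  also have "\<dots> \<le> 1 / 2" using c_ge[of n] by (simp add: field_simps)
  finally have "N n * \<Delta> n * (d n * \<mu> n) \<le> N n * \<Delta> n * (1 / 2)"
    using N_pos[of n] \<Delta>_pos[of n] by (intro mult_left_mono) auto
  then show ?thesis by (simp add: N_def \<Delta>_def mult_ac)
qed

lemma N_\<Delta>_tendsto_0: "(\<lambda>n. N n * \<Delta> n) \<longlonglongrightarrow> 0"
proof -
  have le: "N (Suc n) * \<Delta> (Suc n) \<le> N 1 * \<Delta> 1 * (1 / 2) ^ n" for n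
  proof (induction n)
    case (Suc n)
    then show ?case using N_\<Delta>_Suc[of "Suc n"] by simp
  qed simp
  have "(\<lambda>n. N (Suc n) * \<Delta> (Suc n)) \<longlonglongrightarrow> 0"
  proof (rule tendsto_sandwich[where f="\<lambda>_. 0" and h="\<lambda>n. N 1 * \<Delta> 1 * (1 / 2) ^ n"])
    show "\<forall>\<^sub>F n in sequentially. 0 \<le> N (Suc n) * \<Delta> (Suc n)"
      using N_pos \<Delta>_pos by (simp add: less_imp_le)
    show "(\<lambda>n. N 1 * \<Delta> 1 * (1 / 2) ^ n) \<longlonglongrightarrow> 0"
      by (intro tendsto_mult_right_zero LIMSEQ_power_zero) simp
  qed (use le in auto)
  then show ?thesis by (rule LIMSEQ_imp_Suc)
qed

text \<open>The pieces of level \<open>n\<close> number \<open>N n\<close> and have diameter at most \<open>4 * \<Delta> n\<close>.\<close>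

lemma hausdorff_measure_1_E: "hausdorff_measure 1 E = 0"
proof -
  have small: "hausdorff_content 1 \<epsilon> E \<le> ennreal \<eta>" if "0 < \<epsilon>" "0 < \<eta>" for \<epsilon> \<eta>
  proof -
    have "(\<lambda>n. 4 * (N n * \<Delta> n)) \<longlonglongrightarrow> 0" using N_\<Delta>_tendsto_0 by (rule tendsto_mult_right_zero)
    then have "\<forall>\<^sub>F n in sequentially. 4 * (N n * \<Delta> n) < min \<epsilon> \<eta>"
      by (rule order_tendstoD(2)) (use that in simp)
    then have "\<forall>\<^sub>F n in sequentially. 0 < n \<and> 4 * (N n * \<Delta> n) < min \<epsilon> \<eta>"
      by (intro eventually_conj eventually_gt_at_top)
    then obtain n where n: "0 < n" "4 * (N n * \<Delta> n) < min \<epsilon> \<eta>"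
      using eventually_happens'[OF sequentially_bot] by blast
    define V where "V \<phi> = {x\<in>E. code n x = \<phi>}" for \<phi>
    have dist: "dist x y \<le> 4 * \<Delta> n" if xy: "x \<in> V \<phi>" "y \<in> V \<phi>" for x y \<phi>
      unfolding dist_norm
    proof (rule same_code_dist_le)
      show "x \<in> T n" "y \<in> T n" using xy E_subset_T[of n] by (auto simp: V_def)
      show "rt k x = rt k y" if "k < n" for k
      proof -
        have "code n x k = code n y k" using xy by (simp add: V_def)
        then show ?thesis using that by (simp add: code_def)
      qed
    qed (rule n(1))
    have diam: "bounded (V \<phi>) \<and> diameter (V \<phi>) \<le> 4 * \<Delta> n" for \<phi>
    proof
      show "bounded (V \<phi>)"
        unfolding bounded_two_points using dist[of _ \<phi>] by (intro exI[of _ "4 * \<Delta> n"]) auto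
      show "diameter (V \<phi>) \<le> 4 * \<Delta> n"
      proof (rule diameter_le)
        show "cmod (x - y) \<le> 4 * \<Delta> n" if "x \<in> V \<phi>" "y \<in> V \<phi>" for x y
          using dist[OF that] by (simp only: dist_norm)
      qed (use \<Delta>_pos[of n] in simp)
    qed
    have "4 * \<Delta> n \<le> 4 * (N n * \<Delta> n)"
      using mult_right_mono[OF N_ge_1[of n], of "4 * \<Delta> n"] \<Delta>_pos[of n] by simp
    then have small: "4 * \<Delta> n \<le> \<epsilon>" using n(2) by simp
    have "hausdorff_content 1 \<epsilon> E \<le> (\<Sum>\<phi>\<in>PiE {..<n} Z. ennreal (diameter (V \<phi>) powr 1))"
    proof (rule hausdorff_content_le_finite_cover[OF finite_codes])
      show "E \<subseteq> (\<Union>\<phi>\<in>PiE {..<n} Z. V \<phi>)"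
      proof
        fix x assume "x \<in> E"
        then have "code n x \<in> PiE {..<n} Z" "x \<in> V (code n x)"
          using code_in_PiE[of x n] E_subset_T[of n] by (auto simp only: V_def mem_Collect_eq)
        then show "x \<in> (\<Union>\<phi>\<in>PiE {..<n} Z. V \<phi>)" by blast
      qed
      show "bounded (V \<phi>) \<and> diameter (V \<phi>) \<le> \<epsilon>" for \<phi>
        using diam[of \<phi>] small order_trans by blast
    qed (use that in simp)
    also have "\<dots> \<le> (\<Sum>\<phi>\<in>PiE {..<n} Z. ennreal (4 * \<Delta> n))"
    proof (intro sum_mono ennreal_leI)
      show "diameter (V \<phi>) powr 1 \<le> 4 * \<Delta> n" for \<phi>
        using diam[of \<phi>] diameter_ge_0[of "V \<phi>"] by simp
    qed
    also have "\<dots> = ennreal (\<Sum>\<phi>\<in>PiE {..<n} Z. 4 * \<Delta> n)"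
      using \<Delta>_pos[of n] by (intro sum_ennreal) auto
    also have "(\<Sum>\<phi>\<in>PiE {..<n} Z. 4 * \<Delta> n) = 4 * (N n * \<Delta> n)"
      unfolding sum_constant card_codes by (simp only: mult_ac)
    also have "ennreal \<dots> \<le> ennreal \<eta>" using n(2) by (intro ennreal_leI) simp
    finally show ?thesis .
  qed
  have "hausdorff_content 1 \<epsilon> E \<le> 0" if "0 < \<epsilon>" for \<epsilon>
  proof (rule ennreal_le_epsilon)
    show "hausdorff_content 1 \<epsilon> E \<le> 0 + ennreal \<eta>" if "0 < \<eta>" for \<eta>
      using small[OF \<open>0 < \<epsilon>\<close> that] by simp
  qed
  then have "hausdorff_measure 1 E \<le> 0"
    unfolding hausdorff_measure_def by (intro SUP_least) simp
  then show ?thesis by simp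
qed

text \<open>Passing from \<open>n\<close> to \<open>n + 1\<close> multiplies the quotient of the two sides by
  \<open>(c + 2) powr s / d powr (1 - s)\<close>, which is eventually at most 1.\<close>

lemma ex_mass_bound:
  assumes "0 < s" "s < 1"
  shows "\<exists>B>0. \<forall>n. \<Lambda> n powr s \<le> B * N n"
proof -
  define a where "a n = \<Lambda> n powr s / N n" for n
  obtain n0 where n0: "\<And>k. n0 \<le> k \<Longrightarrow> (c k + 2) powr s \<le> real (d k) powr (1 - s)"
    using d_growth[OF assms] by blast
  have step: "a (Suc k) \<le> a k" if "n0 \<le> k" for k
  proof -
    have d0: "0 < real (d k)" and c0: "0 < c k + 2" using d_pos[of k] c_pos[of k] by auto
    have "(d k * (c k + 2)) powr s = real (d k) powr s * (c k + 2) powr s"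
      using d0 c0 by (intro powr_mult)
    also have "\<dots> \<le> real (d k) powr s * real (d k) powr (1 - s)"
      using n0[OF that] by (intro mult_left_mono) auto
    also have "\<dots> = d k" using d0 by (simp flip: powr_add)
    finally have le: "(d k * (c k + 2)) powr s \<le> d k" .
    have "\<Lambda> (Suc k) powr s = \<Lambda> k powr s * (d k * (c k + 2)) powr s"
      using \<Lambda>_pos[of k] d0 c0 by (simp add: \<Lambda>_def powr_mult)
    also have "\<dots> \<le> \<Lambda> k powr s * d k" using le by (intro mult_left_mono) auto
    finally have "a (Suc k) \<le> \<Lambda> k powr s * d k / N (Suc k)"
      unfolding a_def using N_pos[of "Suc k"] by (intro divide_right_mono) auto
    also have "\<dots> = a k" using d0 by (simp add: a_def N_def)
    finally show ?thesis .
  qed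
  define B where "B = Max (a ` {..n0})"
  have a_le: "a n \<le> B" for n
  proof (induction n)
    case (Suc n)
    show ?case
    proof (cases "n0 \<le> n")
      case True
      then show ?thesis using step[OF True] Suc by linarith
    next
      case False
      then show ?thesis unfolding B_def by (intro Max_ge) auto
    qed
  qed (auto simp: B_def)
  moreover have a_pos: "0 < a n" for n
    unfolding a_def using \<Lambda>_pos[of n] N_pos[of n] by simp
  ultimately have "0 < B" using less_le_trans by blast
  moreover have "\<Lambda> n powr s \<le> B * N n" for n
    using a_le[of n] N_pos[of n] by (simp add: a_def divide_le_eq)
  ultimately show ?thesis by blast
qed

text \<open>A mass distribution estimate: \<open>V\<close> meets at most a multiple of \<open>t powr s\<close> of all the pieces of level
  \<open>m + 1\<close>. The relevant level \<open>n\<close> is the first one whose scale is not larger than \<open>t\<close>.\<close>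

lemma card_codes_le:
  assumes "0 < s" "s < 1" and B: "\<And>n. \<Lambda> n powr s \<le> B * N n"
    and t: "0 < t" "\<And>x y. x \<in> V \<Longrightarrow> y \<in> V \<Longrightarrow> dist x y \<le> t" and m: "\<delta> m \<le> t"
  shows "real (card (code (Suc m) ` (T (Suc m) \<inter> V))) \<le> 5 * B * N (Suc m) * t powr s"
proof (cases "T (Suc m) \<inter> V = {}")
  case True
  have "0 \<le> B" using B[of 0] by (simp add: \<Lambda>_def N_def)
  then show ?thesis using True N_pos[of "Suc m"] by simp
next
  case False
  then obtain y where y: "y \<in> T (Suc m)" "y \<in> V" by blast
  define n where "n = (LEAST n. \<delta> n \<le> t)"
  have n: "\<delta> n \<le> t" "n \<le> m" unfolding n_def using m by (auto intro: LeastI Least_le)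
  have less_n: "t < \<delta> k" if "k < n" for k
    using not_less_Least[OF that[unfolded n_def]] by simp
  let ?W = "T (Suc m) \<inter> V"
  define S where "S = rt n ` ?W"
  define g where "g k = (if k < n then {rt k y} else if k = n then S else Z k)" for k
  have finS: "finite S" and S_Z: "S \<subseteq> Z n"
  proof -
    show "S \<subseteq> Z n" unfolding S_def using rt_in_Z n(2) by auto
    then show "finite S" using finite_Z finite_subset by blast
  qed
  \<comment> \<open>The roots before stage \<open>n\<close> are forced, those after it are unrestricted.\<close>
  have "code (Suc m) ` ?W \<subseteq> PiE {..<Suc m} g"
  proof
    fix \<phi> assume "\<phi> \<in> code (Suc m) ` ?W"
    then obtain x where x: "x \<in> ?W" "\<phi> = code (Suc m) x" by blast
    have "rt k x \<in> g k" if "k < Suc m" for k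
    proof -
      have "rt k x = rt k y" if "k < n"
      proof (rule ccontr)
        assume "rt k x \<noteq> rt k y"
        then have "\<delta> k \<le> cmod (x - y)"
          using x(1) y \<open>k < Suc m\<close> by (intro different_code_dist_ge) auto
        then show False using less_n[OF that] t(2)[of x y] x(1) y by (simp add: dist_norm)
      qed
      moreover have "rt k x \<in> Z k" using rt_in_Z x(1) that by auto
      ultimately show ?thesis using x(1) by (auto simp: g_def S_def)
    qed
    then show "\<phi> \<in> PiE {..<Suc m} g" unfolding x(2) code_def by auto
  qed
  moreover have "finite (PiE {..<Suc m} g)"
    by (intro finite_PiE) (auto simp: g_def finS finite_Z)
  ultimately have "card (code (Suc m) ` ?W) \<le> card (PiE {..<Suc m} g)"
    by (intro card_mono)
  also have "\<dots> = (\<Prod>k<Suc m. card (g k))" by (simp add: card_PiE)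
  finally have le: "real (card (code (Suc m) ` ?W)) \<le> (\<Prod>k<Suc m. real (card (g k)))"
    by (metis of_nat_le_iff of_nat_prod)
  define R where "R = (\<Prod>k\<in>{Suc n..<Suc m}. real (d k))"
  have split: "{..<Suc m} = {..<Suc n} \<union> {Suc n..<Suc m}" using n(2) by auto
  have "(\<Prod>k<Suc m. real (card (g k))) = (\<Prod>k<Suc n. real (card (g k))) * R"
    unfolding split R_def by (subst prod.union_disjoint) (auto simp: g_def card_Z)
  also have "(\<Prod>k<Suc n. real (card (g k))) = real (card S)"
    by (simp add: g_def)
  finally have prod_g: "(\<Prod>k<Suc m. real (card (g k))) = real (card S) * R" .
  have N_split: "N (Suc m) = N n * d n * R"
    unfolding N_def split R_def by (subst prod.union_disjoint) auto
  have R0: "0 \<le> R" unfolding R_def by (intro prod_nonneg) auto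
  define \<tau> where "\<tau> = \<Lambda> n * t"
  have d0: "0 < real (d n)" using d_pos[of n] by simp
  have \<tau>_pos: "0 < \<tau>" unfolding \<tau>_def using \<Lambda>_pos[of n] t(1) by simp
  have d\<tau>: "1 \<le> d n * \<tau>"
    using n(1) \<Lambda>_pos[of n] d0 unfolding \<tau>_def \<delta>_def by (simp add: field_simps)
  have "real (card S) \<le> 2 * real (d n) * \<tau> + 3"
    unfolding S_def
  proof (rule card_roots_le)
    fix x x' assume xx: "x \<in> ?W" "x' \<in> ?W"
    then have "cmod (F n x - F n x') \<le> \<Lambda> n * cmod (x - x')"
      using n(2) by (intro F_expansion_le[of _ "Suc m"]) auto
    also have "\<dots> \<le> \<tau>"
      unfolding \<tau>_def using t(2)[of x x'] xx \<Lambda>_pos[of n] by (intro mult_left_mono) (auto simp: dist_norm)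
    finally show "cmod (F n x - F n x') \<le> \<tau>" .
  qed (use n \<tau>_pos in auto)
  then have S1: "real (card S) \<le> d n * (5 * \<tau>)" using d\<tau> by (simp add: mult_ac)
  have S2: "real (card S) \<le> d n"
    using card_mono[OF finite_Z S_Z] by (simp add: card_Z)
  have "real (card S) \<le> d n * (5 * \<tau> powr s)"
  proof (cases "\<tau> \<le> 1")
    case True
    then have "\<tau> \<le> \<tau> powr s" using powr_mono'[of s 1 \<tau>] \<tau>_pos assms by simp
    then have "d n * (5 * \<tau>) \<le> d n * (5 * \<tau> powr s)" by (intro mult_left_mono) auto
    then show ?thesis using S1 by linarith
  next
    case False
    then have "1 \<le> \<tau> powr s" using assms by (simp add: ge_one_powr_ge_zero)
    then have "real (d n) * 1 \<le> d n * (5 * \<tau> powr s)" by (intro mult_left_mono) auto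
    then show ?thesis using S2 by linarith
  qed
  also have "\<tau> powr s \<le> B * N n * t powr s"
    unfolding \<tau>_def using B[of n] \<Lambda>_pos[of n] t(1) by (simp add: powr_mult mult_right_mono)
  finally have "real (card S) \<le> d n * (5 * (B * N n * t powr s))" by (simp add: mult_left_mono)
  then have "real (card S) * R \<le> d n * (5 * (B * N n * t powr s)) * R"
    using R0 by (intro mult_right_mono)
  then show ?thesis using le prod_g N_split by (simp add: mult_ac)
qed

text \<open>An open cover of \<open>E\<close> also covers the compact set \<open>T m\<close> for large \<open>m\<close>, which contains points of all
  itineraries of length \<open>m\<close>.\<close>

lemma hausdorff_measure_E_pos:
  assumes "0 < s" "s < 1"
  shows "hausdorff_measure s E \<noteq> 0"
proof -
  obtain B where B0: "0 < B" and B: "\<And>n. \<Lambda> n powr s \<le> B * N n"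
    using ex_mass_bound[OF assms] by blast
  have "ennreal (1 / (10 * B)) \<le> hausdorff_content s 1 E"
  proof (rule hausdorff_content_ge_open_covers[OF compact_E assms(1)])
    fix I :: "nat set" and V t
    assume I: "finite I" "E \<subseteq> (\<Union>i\<in>I. V i)"
      and V: "\<And>i. i \<in> I \<Longrightarrow> open (V i) \<and> 0 < t i \<and> (\<forall>x\<in>V i. \<forall>y\<in>V i. dist x y \<le> t i)"
    have "\<exists>m0. T (Suc m0) \<subseteq> (\<Union>i\<in>I. V i)"
    proof (rule ccontr)
      assume "\<nexists>m0. T (Suc m0) \<subseteq> (\<Union>i\<in>I. V i)"
      then have ne: "T (Suc n) - (\<Union>i\<in>I. V i) \<noteq> {}" for n by blast
      have "\<Inter>(range (\<lambda>n. T (Suc n) - (\<Union>i\<in>I. V i))) \<noteq> {}"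
      proof (rule compact_nest)
        show "compact (T (Suc n) - (\<Union>i\<in>I. V i))" for n
          using V by (intro compact_diff compact_T open_UN) auto
        show "T (Suc n) - (\<Union>i\<in>I. V i) \<subseteq> T (Suc m) - (\<Union>i\<in>I. V i)" if "m \<le> n" for m n
          using T_antimono[of "Suc m" "Suc n"] that by auto
      qed (rule ne)
      then obtain x where x: "\<And>n. x \<in> T (Suc n)" "x \<notin> (\<Union>i\<in>I. V i)" by blast
      have "x \<in> E" using x(1) unfolding E_def T_def by blast
      then show False using x(2) I(2) by blast
    qed
    then obtain m0 where m0: "T (Suc m0) \<subseteq> (\<Union>i\<in>I. V i)" by blast
    have "\<forall>\<^sub>F m in sequentially. m0 \<le> m \<and> (\<forall>i\<in>I. \<delta> m < t i)"
      using I(1) V order_tendstoD(2)[OF \<delta>_tendsto_0]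
      by (intro eventually_conj eventually_ge_at_top eventually_ball_finite) auto
    then obtain m where m: "m0 \<le> m" "\<And>i. i \<in> I \<Longrightarrow> \<delta> m < t i"
      using eventually_happens'[OF sequentially_bot] by blast
    let ?C = "\<lambda>i. code (Suc m) ` (T (Suc m) \<inter> V i)"
    have "T (Suc m) \<subseteq> (\<Union>i\<in>I. V i)" using m0 T_antimono[of "Suc m0" "Suc m"] m(1) by (meson Suc_le_mono subset_trans)
    then have "T (Suc m) = (\<Union>i\<in>I. T (Suc m) \<inter> V i)" by blast
    then have "code (Suc m) ` T (Suc m) = (\<Union>i\<in>I. ?C i)" by (metis image_UN)
    then have "PiE {..<Suc m} Z \<subseteq> (\<Union>i\<in>I. ?C i)" using code_onto[of "Suc m"] by simp
    moreover have fin: "finite (?C i)" for i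
      by (rule finite_subset[OF _ finite_codes[of "Suc m"]]) (auto dest: code_in_PiE)
    ultimately have "card (PiE {..<Suc m} Z) \<le> card (\<Union>i\<in>I. ?C i)"
      using I(1) by (intro card_mono) auto
    also have "\<dots> \<le> (\<Sum>i\<in>I. card (?C i))" by (rule card_UN_le[OF I(1)])
    finally have "N (Suc m) \<le> (\<Sum>i\<in>I. real (card (?C i)))"
      unfolding card_codes[symmetric] by (metis of_nat_le_iff of_nat_sum)
    also have "\<dots> \<le> (\<Sum>i\<in>I. 5 * B * N (Suc m) * t i powr s)"
      using V m(2) by (intro sum_mono card_codes_le[OF assms B]) (auto intro: less_imp_le)
    also have "\<dots> = N (Suc m) * (5 * B * (\<Sum>i\<in>I. t i powr s))"
      by (simp add: sum_distrib_left mult_ac)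
    finally have "1 \<le> 5 * B * (\<Sum>i\<in>I. t i powr s)"
      using N_pos[of "Suc m"] by simp
    then show "2 * (1 / (10 * B)) \<le> (\<Sum>i\<in>I. t i powr s)"
      using B0 by (simp add: field_simps)
  qed (use B0 in simp)
  also have "\<dots> \<le> hausdorff_measure s E"
    unfolding hausdorff_measure_def by (rule SUP_upper) simp
  finally show ?thesis using B0 by (auto simp: ennreal_eq_0_iff)
qed

lemma HD_E: "HD E = 1"
  using hausdorff_measure_1_E hausdorff_measure_E_pos by (rule HD_eq_1I)

text \<open>Needed for the outer component of a separating annulus; a set of at most one point has dimension 0.\<close>

lemma ex_other_point: "\<exists>w\<in>E. w \<noteq> z"
  using hausdorff_measure_subset_singleton[of "1 / 2" E z] hausdorff_measure_E_pos[of "1 / 2"] by auto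

subsection \<open>Thinness\<close>

text \<open>Up to a factor 4, the reciprocal of the quotient is \<open>\<Lambda> n * \<Delta> n\<close>, which collects the bounds at the
  earlier stages and grows at most like \<open>8 ^ n\<close>, times \<open>d n * \<mu> n\<close>, which is of order \<open>1 / c n\<close>.\<close>

lemma modulus_at_top: "filterlim (\<lambda>n. \<delta> n / (4 * \<Delta> (Suc n))) at_top sequentially"
proof -
  define W where "W n = \<Lambda> n * \<Delta> n" for n
  have W_pos: "0 < W n" for n unfolding W_def using \<Lambda>_pos \<Delta>_pos by simp
  have W_Suc: "W (Suc n) \<le> W n * 8" if "0 < n" for n
  proof -
    have "W (Suc n) = W n * (d n * (c n + 2) * \<mu> n)"
      by (simp add: W_def \<Lambda>_def \<Delta>_def mult_ac)
    also have "d n * (c n + 2) * \<mu> n = 4 * (c n + 2) / (c n - 2)"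
      unfolding \<mu>_def \<rho>_def using that d_pos[of n] by simp
    also have "\<dots> \<le> 8" using c_ge[of n] by (simp add: divide_le_eq)
    finally show ?thesis using W_pos[of n] by (simp add: mult_left_mono)
  qed
  have W_le: "W (Suc n) \<le> W 1 * 8 ^ n" for n
  proof (induction n)
    case (Suc n)
    then show ?case using W_Suc[of "Suc n"] by simp
  qed simp
  have le: "8 ^ Suc n / (4 * W 1) \<le> \<delta> (Suc n) / (4 * \<Delta> (Suc (Suc n)))" for n
  proof -
    let ?n = "Suc n"
    have "d ?n * \<mu> ?n = 4 / (c ?n - 2)"
      unfolding \<mu>_def \<rho>_def using d_pos[of ?n] by simp
    also have "\<dots> \<le> 8 / c ?n" using c_ge[of ?n] by (simp add: field_simps)
    also have "\<dots> \<le> 8 / 64 ^ ?n" using c_growth[of ?n] c_pos[of ?n]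
      by (intro divide_left_mono) auto
    finally have "W ?n * (d ?n * \<mu> ?n) \<le> W 1 * 8 ^ n * (8 / 64 ^ ?n)"
      using W_le[of n] W_pos[of 1] \<mu>_pos[of ?n] by (intro mult_mono) auto
    also have "\<dots> = W 1 / 8 ^ ?n"
      by (simp add: field_simps flip: power_mult_distrib)
    finally have "1 / (4 * (W 1 / 8 ^ ?n)) \<le> 1 / (4 * (W ?n * (d ?n * \<mu> ?n)))"
      using W_pos[of 1] W_pos[of ?n] d_pos[of ?n] \<mu>_pos[of ?n]
      by (intro divide_left_mono mult_left_mono mult_pos_pos) auto
    moreover have "\<delta> ?n / (4 * \<Delta> (Suc ?n)) = 1 / (4 * (W ?n * (d ?n * \<mu> ?n)))"
      unfolding \<delta>_def W_def by (simp add: \<Delta>_def mult_ac)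
    ultimately show ?thesis by simp
  qed
  have "filterlim (\<lambda>n. 8 ^ Suc n / (4 * W 1)) at_top sequentially"
  proof -
    have "filterlim (\<lambda>n. 2 / W 1 * 8 ^ n) at_top sequentially"
      using W_pos[of 1]
      by (intro filterlim_tendsto_pos_mult_at_top[OF tendsto_const]
          filterlim_at_infinity_imp_filterlim_at_top filterlim_realpow_sequentially_gt1) auto
    then show ?thesis by simp
  qed
  then have "filterlim (\<lambda>n. \<delta> (Suc n) / (4 * \<Delta> (Suc (Suc n)))) at_top sequentially"
    by (rule filterlim_at_top_mono) (intro always_eventually allI le)
  then show ?thesis
    by (rule filterlim_sequentially_Suc[where f="\<lambda>n. \<delta> n / (4 * \<Delta> (Suc n))", THEN iffD1])
qed

lemma annulus_disjoint_E:
  assumes "z \<in> E"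
  shows "E \<inter> annulus z (4 * \<Delta> (Suc n)) (\<delta> n) = {}"
proof -
  have "cmod (y - z) \<le> 4 * \<Delta> (Suc n) \<or> \<delta> n \<le> cmod (y - z)" if "y \<in> E" for y
  proof (cases "\<forall>k<Suc n. rt k y = rt k z")
    case True
    then show ?thesis using that assms E_subset_T by (intro disjI1 same_code_dist_le) auto
  next
    case False
    then obtain k where k: "k < Suc n" "rt k y \<noteq> rt k z" by blast
    have "\<delta> k \<le> cmod (y - z)"
      using that assms E_subset_T k by (intro different_code_dist_ge[of _ "Suc n"]) auto
    then show ?thesis using decseqD[OF \<delta>_antimono, of k n] k(1) by simp
  qed
  then show ?thesis by (force simp: annulus_def)
qed

lemma pointwise_thin_E: "pointwise_thin E"
  unfolding pointwise_thin_def
proof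
  fix z assume z: "z \<in> E"
  obtain w where w: "w \<in> E" "w \<noteq> z" using ex_other_point by blast
  have "\<forall>\<^sub>F n in sequentially. \<delta> n < dist z w"
    using \<delta>_tendsto_0 w(2) by (intro order_tendstoD) auto
  moreover have "\<forall>\<^sub>F n in sequentially. 1 < \<delta> n / (4 * \<Delta> (Suc n))"
    using modulus_at_top by (simp add: filterlim_at_top_dense)
  ultimately have "\<forall>\<^sub>F n in sequentially. \<delta> n < dist z w \<and> 1 < \<delta> n / (4 * \<Delta> (Suc n))"
    by (rule eventually_conj)
  then obtain n0 where n0: "\<And>n. n0 \<le> n \<Longrightarrow> \<delta> n < dist z w"
      "\<And>n. n0 \<le> n \<Longrightarrow> 1 < \<delta> n / (4 * \<Delta> (Suc n))"
    unfolding eventually_sequentially by blast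
  \<comment> \<open>Start late enough for the annuli to be nonempty and to leave a second point of \<open>E\<close> outside.\<close>
  let ?r = "\<lambda>n. 4 * \<Delta> (Suc (n + n0))" and ?R = "\<lambda>n. \<delta> (n + n0)"
  have rR: "0 < ?r n" "?r n < ?R n" for n
    using n0(2)[of "n + n0"] \<Delta>_pos[of "Suc (n + n0)"] by (auto simp: less_divide_eq)
  have "separates (annulus z (?r n) (?R n)) E" for n
    unfolding separates_round_annulus[OF rR]
  proof (intro conjI)
    show "E \<inter> annulus z (?r n) (?R n) = {}" by (rule annulus_disjoint_E[OF z])
    have "z \<in> E \<inter> cball z (?r n)" using z rR(1)[of n] by simp
    then show "E \<inter> cball z (?r n) \<noteq> {}" by blast
    show "\<not> E \<subseteq> ball z (?R n)" using w(1) n0(1)[of "n + n0"] by force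
  qed
  moreover have "filterlim (\<lambda>n. ?R n / ?r n) at_top sequentially"
    using filterlim_compose[OF modulus_at_top filterlim_add_const_nat_at_top[of n0]] .
  moreover have "?R \<longlonglongrightarrow> 0" using \<delta>_tendsto_0 by (rule LIMSEQ_ignore_initial_segment)
  ultimately show "\<exists>r R. (\<forall>n. 0 < r n \<and> r n < R n) \<and>
      filterlim (\<lambda>n. R n / r n) at_top sequentially \<and> R \<longlonglongrightarrow> 0 \<and>
      (\<forall>n. separates (annulus z (r n) (R n)) E)"
    using rR by (intro exI[of _ ?r] exI[of _ ?R]) auto
qed

lemma HNUP_E: "HNUP E"
  using compact_E pointwise_thin_E by (rule pointwise_thin_imp_HNUP)

end

section \<open>The iterated Julia sets\<close>

lemma M_0: "M ms 0 = 0"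
  by (simp add: M_def)

lemma M_Suc: "M ms (Suc k) = M ms k + (ms (Suc k) + 1)"
  by (simp add: M_def)

lemma strict_mono_M: "strict_mono (M ms)"
  by (simp add: strict_mono_Suc_iff M_Suc)

lemma M_mono: "i \<le> j \<Longrightarrow> M ms i \<le> M ms j"
  by (simp add: strict_mono_less_eq[OF strict_mono_M])

lemma P_at_M: "1 \<le> k \<Longrightarrow> P c ms (M ms k) z = z\<^sup>2 + c k"
proof -
  assume k: "1 \<le> k"
  have "(THE j. 1 \<le> j \<and> M ms k = M ms j) = k"
    using k strict_mono_eq[OF strict_mono_M] by (intro the_equality) auto
  then show ?thesis unfolding P_def using k by auto
qed

lemma P_between:
  assumes "M ms k < n" "n < M ms (Suc k)"
  shows "P c ms n z = z\<^sup>2"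
proof -
  have "n \<noteq> M ms j" for j
    using assms strict_mono_less[OF strict_mono_M, of ms] by (metis not_less_eq less_antisym less_irrefl)
  then show ?thesis by (simp add: P_def)
qed

lemma Q_between:
  assumes "m \<le> n" "M ms k \<le> n"
  shows "n + j < M ms (Suc k) \<Longrightarrow> Q c ms m (n + j) z = Q c ms m n z ^ 2 ^ j"
proof (induction j)
  case (Suc j)
  have "Q c ms m (n + Suc j) z = P c ms (Suc (n + j)) (Q c ms m (n + j) z)"
    using assms by simp
  also have "\<dots> = (Q c ms m (n + j) z)\<^sup>2"
    by (rule P_between[of _ k]) (use assms Suc.prems in auto)
  also have "\<dots> = Q c ms m n z ^ 2 ^ Suc j"
    using Suc by (simp flip: power_mult add: mult.commute)
  finally show ?case .
qed simp

lemma Q_M_Suc: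
  assumes "m \<le> n" "M ms k \<le> n" "n < M ms (Suc k)"
  shows "Q c ms m (M ms (Suc k)) z = Q c ms m n z ^ 2 ^ (M ms (Suc k) - n) + c (Suc k)"
proof -
  obtain j where j: "M ms (Suc k) = Suc (n + j)" using assms(3) less_imp_Suc_add by blast
  have "Q c ms m (M ms (Suc k)) z = P c ms (M ms (Suc k)) (Q c ms m (n + j) z)"
    unfolding j using assms(1) by simp
  also have "\<dots> = (Q c ms m (n + j) z)\<^sup>2 + c (Suc k)" by (rule P_at_M) simp
  also have "Q c ms m (n + j) z = Q c ms m n z ^ 2 ^ j"
    using j by (intro Q_between[OF assms(1,2)]) simp
  finally show ?thesis unfolding j by (simp flip: power_mult add: mult.commute Suc_diff_le)
qed

lemma P_eq: "\<exists>a. P c ms n = (\<lambda>z. z\<^sup>2 + a)"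
  by (cases "\<exists>k\<ge>1. n = M ms k") (auto simp: P_def fun_eq_iff)

lemma continuous_Q: "continuous_on UNIV (Q c ms m n)"
proof (induction n)
  case (Suc n)
  obtain a where a: "P c ms (Suc n) = (\<lambda>z. z\<^sup>2 + a)" using P_eq by blast
  have "continuous_on UNIV (P c ms (Suc n))" unfolding a by (intro continuous_intros)
  then have "continuous_on UNIV (P c ms (Suc n) \<circ> Q c ms m n)"
    using Suc by (intro continuous_on_compose) (auto intro: continuous_on_subset)
  then show ?case by (simp add: id_def)
qed (simp add: id_def)

text \<open>Polynomials tend to infinity at infinity.\<close>

lemma bounded_Q_vimage: "m \<le> n \<Longrightarrow> \<exists>B. \<forall>z. cmod (Q c ms m n z) \<le> A \<longrightarrow> cmod z \<le> B"
proof (induction n arbitrary: A)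
  case 0
  then show ?case by auto
next
  case (Suc n)
  show ?case
  proof (cases "m = Suc n")
    case False
    obtain a where P: "P c ms (Suc n) = (\<lambda>z. z\<^sup>2 + a)" using P_eq by blast
    obtain B where B: "\<And>z. cmod (Q c ms m n z) \<le> max 1 (A + cmod a) \<Longrightarrow> cmod z \<le> B"
      using Suc False by (metis le_Suc_eq)
    have "cmod z \<le> B" if z: "cmod (Q c ms m (Suc n) z) \<le> A" for z
    proof (rule B)
      let ?w = "Q c ms m n z"
      have "(cmod ?w)\<^sup>2 \<le> A + cmod a"
        using z Suc.prems False norm_diff_ineq[of "?w\<^sup>2" a] by (simp add: P norm_power le_Suc_eq)
      then show "cmod ?w \<le> max 1 (A + cmod a)"
        using self_le_power[of "cmod ?w" 2] by (cases "cmod ?w \<le> 1") auto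
    qed
    then show ?thesis by blast
  qed (auto simp: id_def)
qed

lemma compact_Q_vimage:
  assumes "m \<le> n"
  shows "compact {z. cmod (Q c ms m n z) \<le> A}"
proof -
  have "closed {z. cmod (Q c ms m n z) \<le> A}"
    by (intro closed_Collect_le continuous_on_norm continuous_Q continuous_on_const)
  moreover have "bounded {z. cmod (Q c ms m n z) \<le> A}"
    using bounded_Q_vimage[OF assms] unfolding bounded_iff by blast
  ultimately show ?thesis by (simp add: compact_eq_bounded_closed)
qed

lemma ex_block:
  assumes "M ms k \<le> n"
  shows "\<exists>j\<ge>k. M ms j \<le> n \<and> n < M ms (Suc j)"
proof -
  define j where "j = (GREATEST j. M ms j \<le> n)"
  have bound: "i \<le> n" if "M ms i \<le> n" for i
    using that strict_mono_imp_increasing[OF strict_mono_M, of i ms] by simp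
  have "M ms j \<le> n"
    unfolding j_def by (rule GreatestI_nat[where P="\<lambda>j. M ms j \<le> n", OF assms bound])
  moreover have le_j: "i \<le> j" if "M ms i \<le> n" for i
    unfolding j_def by (rule Greatest_le_nat[where P="\<lambda>j. M ms j \<le> n", OF that bound])
  moreover have "n < M ms (Suc j)"
  proof (rule ccontr)
    assume "\<not> n < M ms (Suc j)"
    then show False using le_j[of "Suc j"] by simp
  qed
  ultimately show ?thesis using assms by blast
qed

text \<open>If the maps converge along the whole sequence, then a sequence chosen from them either repeats
  one of them infinitely often or runs through the sequence.\<close>

lemma normal_on_of_uniform_limit:
  assumes "uniform_limit U q l sequentially" and "\<F> \<subseteq> range q"
  shows "normal_on \<F> U"
  unfolding normal_on_def
proof (intro allI impI)
  fix f :: "nat \<Rightarrow> riemann_sphere \<Rightarrow> riemann_sphere" assume "range f \<subseteq> \<F>"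
  then have "\<forall>i. \<exists>j. f i = q j" using assms(2) by blast
  then obtain \<nu> where \<nu>: "\<And>i. f i = q (\<nu> i)" by metis
  have "\<exists>g r. strict_mono (r :: nat \<Rightarrow> nat) \<and> uniform_limit U (f \<circ> r) g sequentially"
  proof (cases "\<exists>j. infinite {i. \<nu> i = j}")
    case True
    then obtain j r where "strict_mono (r :: nat \<Rightarrow> nat)" "\<And>i. r i \<in> {i. \<nu> i = j}"
      using infinite_enumerate by metis
    moreover then have "f \<circ> r = (\<lambda>_. q j)" by (auto simp: \<nu>)
    ultimately show ?thesis
      by (intro exI[of _ "q j"] exI[of _ r]) (auto intro: uniform_limit_const)
  next
    case False
    have "filterlim \<nu> at_top sequentially"
      unfolding filterlim_at_top
    proof
      fix n
      have "{i. \<nu> i < n} = (\<Union>j<n. {i. \<nu> i = j})" by auto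
      then have "finite {i. \<nu> i < n}" using False by simp
      then show "\<forall>\<^sub>F i in sequentially. n \<le> \<nu> i"
        by (simp add: cofinite_eq_sequentially[symmetric] eventually_cofinite not_le)
    qed
    then have "uniform_limit U (\<lambda>i. q (\<nu> i)) l sequentially"
      using assms(1) unfolding uniform_limit_iff by (auto intro: eventually_compose_filterlim)
    then have "uniform_limit U (f \<circ> id) l sequentially" by (simp add: \<nu> comp_def)
    then show ?thesis using strict_mono_id by blast
  qed
  then show "\<exists>g r. strict_mono (r :: nat \<Rightarrow> nat) \<and>
      (\<forall>K. compact K \<and> K \<subseteq> U \<longrightarrow> uniform_limit K (f \<circ> r) g sequentially)"
    using uniform_limit_on_subset by blast
qed

locale quadratic_blocks =
  fixes c :: "nat \<Rightarrow> complex" and ms :: "nat \<Rightarrow> nat"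
  assumes ms_pos: "1 \<le> k \<Longrightarrow> 0 < ms k"
    and large_block: "1 \<le> k \<Longrightarrow> (2::real) ^ 2 ^ ms k \<ge> 2 * sqrt (cmod (c k))"
begin

lemma c_le_block: "4 * cmod (c (Suc k)) \<le> 2 ^ 2 ^ (ms (Suc k) + 1)"
proof -
  have "(2 * sqrt (cmod (c (Suc k))))\<^sup>2 \<le> (2 ^ 2 ^ ms (Suc k))\<^sup>2"
    using large_block[of "Suc k"] by (intro power_mono) auto
  then show ?thesis by (simp add: power_mult_distrib mult.commute flip: power_mult)
qed

text \<open>The leading term wins, because \<open>c_le_block\<close> bounds the constant by a quarter of it outside the disc of
  radius 2.\<close>

lemma escape_Suc:
  assumes "m \<le> M ms k" "2 < cmod (Q c ms m (M ms k) z)"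
  shows "2 * cmod (Q c ms m (M ms k) z) \<le> cmod (Q c ms m (M ms (Suc k)) z)"
proof -
  define u where "u = Q c ms m (M ms k) z"
  define e :: nat where "e = 2 ^ (ms (Suc k) + 1)"
  have u: "2 < cmod u" using assms(2) by (simp add: u_def)
  have "(2::nat) ^ 2 \<le> e" unfolding e_def using ms_pos[of "Suc k"] by (intro power_increasing) auto
  then have e: "4 \<le> e" by simp
  have Q: "Q c ms m (M ms (Suc k)) z = u ^ e + c (Suc k)"
    using Q_M_Suc[where n="M ms k" and ms=ms and k=k, OF assms(1), of c z] by (simp add: u_def e_def M_Suc)
  have "4 * cmod (c (Suc k)) \<le> 2 ^ e" unfolding e_def by (rule c_le_block)
  also have "\<dots> \<le> cmod u ^ e" using u by (intro power_mono) auto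
  finally have "3 / 4 * cmod u ^ e \<le> cmod (u ^ e + c (Suc k))"
    using norm_diff_ineq[of "u ^ e" "c (Suc k)"] by (simp add: norm_power)
  moreover have "cmod u ^ 4 \<le> cmod u ^ e" using u e by (intro power_increasing) auto
  moreover have "8 * cmod u \<le> cmod u ^ 4"
    using mult_right_mono[OF power_mono[of 2 "cmod u" 3], of "cmod u"] u
    by (simp add: power4_eq_xxxx power3_eq_cube)
  ultimately have "2 * cmod u \<le> cmod (u ^ e + c (Suc k))" using u by linarith
  then show ?thesis unfolding Q u_def .
qed

lemma escape_add:
  assumes "m \<le> M ms k" "2 < cmod (Q c ms m (M ms k) z)"
  shows "2 * 2 ^ i < cmod (Q c ms m (M ms (k + i)) z)"
proof (induction i)
  case (Suc i)
  have "m \<le> M ms (k + i)" using assms(1) M_mono[of k "k + i" ms] by simp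
  moreover have "2 < cmod (Q c ms m (M ms (k + i)) z)"
    using Suc one_le_power[of 2 i] by (smt (verit))
  ultimately show ?case using escape_Suc[of m "k + i" z] Suc by simp
qed (use assms in simp)

lemma escape_all:
  assumes "m \<le> M ms k" "2 < cmod (Q c ms m (M ms k) z)" "M ms (k + i) \<le> n"
  shows "2 ^ i \<le> cmod (Q c ms m n z)"
proof -
  obtain j where j: "k + i \<le> j" "M ms j \<le> n" "n < M ms (Suc j)"
    using ex_block[OF assms(3)] by blast
  have mj: "m \<le> M ms j" using assms(1) j(1) M_mono[of k j ms] by simp
  have big: "2 * 2 ^ (j - k) < cmod (Q c ms m (M ms j) z)"
    using escape_add[OF assms(1,2), of "j - k"] j(1) by simp
  then have ge_1: "1 \<le> cmod (Q c ms m (M ms j) z)"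
    using one_le_power[of "2::real" "j - k"] by linarith
  have "(2::real) ^ i \<le> 2 ^ (j - k)" using j(1) by (intro power_increasing) auto
  also have "\<dots> \<le> cmod (Q c ms m (M ms j) z)" using big one_le_power[of "2::real" "j - k"] by linarith
  also have "\<dots> \<le> cmod (Q c ms m (M ms j) z) ^ 2 ^ (n - M ms j)"
    using ge_1 by (intro self_le_power) auto
  also have "\<dots> = cmod (Q c ms m n z)"
    using Q_between[of m "M ms j" ms j "n - M ms j" c z] mj j by (simp add: norm_power)
  finally show ?thesis .
qed

definition survivors :: "nat \<Rightarrow> complex set" where
  "survivors m = {z. \<forall>k. m < M ms k \<longrightarrow> cmod (Q c ms m (M ms k) z) \<le> 2}"

text \<open>After \<open>i\<close> more blocks the modulus is at least \<open>2 ^ i\<close>, whatever the point.\<close>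

lemma uniform_escape:
  assumes "m \<le> M ms k"
  shows "uniform_limit (- (Fin ` {z. cmod (Q c ms m (M ms k) z) \<le> 2}))
    (\<lambda>n. sphere_ext (Q c ms m n)) (\<lambda>_. Infty) sequentially"
  unfolding uniform_limit_iff
proof (intro allI impI)
  fix e :: real assume "0 < e"
  then obtain b where b: "\<And>w. b \<le> cmod w \<Longrightarrow> dist (Fin w) Infty < e"
    using tendstoD[OF Fin_tendsto_Infty] unfolding eventually_at_infinity by blast
  obtain i where i: "b < 2 ^ i" using real_arch_pow[of 2 b] by auto
  have "dist (sphere_ext (Q c ms m n) p) Infty < e"
    if "M ms (k + i) \<le> n" "p \<in> - (Fin ` {z. cmod (Q c ms m (M ms k) z) \<le> 2})" for n p
  proof (cases p)
    case (Fin z)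
    then have "2 < cmod (Q c ms m (M ms k) z)" using that(2) by force
    then have "b \<le> cmod (Q c ms m n z)" using escape_all[OF assms _ that(1)] i by fastforce
    then show ?thesis using b Fin by (simp add: sphere_ext_def)
  qed (use \<open>0 < e\<close> in \<open>simp add: sphere_ext_def\<close>)
  then show "\<forall>\<^sub>F n in sequentially. \<forall>p\<in>- (Fin ` {z. cmod (Q c ms m (M ms k) z) \<le> 2}).
      dist (sphere_ext (Q c ms m n) p) Infty < e"
    unfolding eventually_sequentially by blast
qed

lemma escaping_in_Fatou:
  assumes "m \<le> M ms k" "p \<notin> Fin ` {z. cmod (Q c ms m (M ms k) z) \<le> 2}"
  shows "p \<in> Fatou c ms m"
proof -
  let ?U = "- (Fin ` {z. cmod (Q c ms m (M ms k) z) \<le> 2})"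
  have "open ?U" using closed_Fin_compact_image[OF compact_Q_vimage[OF assms(1)]] by auto
  moreover have "normal_on {sphere_ext (Q c ms m n) |n. m \<le> n} ?U"
    by (rule normal_on_of_uniform_limit[OF uniform_escape[OF assms(1)]]) auto
  ultimately show ?thesis unfolding Fatou_def using assms(2) by blast
qed

lemma M_gt: "m < M ms (Suc (m + i))"
  using strict_mono_imp_increasing[OF strict_mono_M, of "Suc (m + i)" ms] by simp

lemma Julia_subset_survivors: "Julia c ms m \<subseteq> Fin ` survivors m"
proof
  fix p assume "p \<in> Julia c ms m"
  then have *: "p \<in> Fin ` {z. cmod (Q c ms m (M ms k) z) \<le> 2}" if "m < M ms k" for k
    using escaping_in_Fatou[of m k p] that unfolding Julia_def by auto
  obtain z where z: "p = Fin z" using *[OF M_gt[of m 0]] by blast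
  then have "z \<in> survivors m" unfolding survivors_def using * by auto
  then show "p \<in> Fin ` survivors m" using z by blast
qed

text \<open>On a neighbourhood where the family is normal the limit is continuous; it is \<open>\<infinity>\<close> at the
  escaping points and finite at the survivors.\<close>

lemma survivor_in_Julia:
  assumes z: "z \<in> survivors m" and dense: "z \<in> closure (- survivors m)"
  shows "Fin z \<in> Julia c ms m"
  unfolding Julia_def
proof
  assume "Fin z \<in> Fatou c ms m"
  then obtain U where U: "open U" "Fin z \<in> U"
    and normal: "normal_on {sphere_ext (Q c ms m n) |n. m \<le> n} U"
    unfolding Fatou_def by blast
  define \<nu> where "\<nu> i = M ms (Suc (m + i))" for i
  have \<nu>: "m < \<nu> i" for i unfolding \<nu>_def by (rule M_gt)
  have range: "range (\<lambda>i. sphere_ext (Q c ms m (\<nu> i))) \<subseteq> {sphere_ext (Q c ms m n) |n. m \<le> n}"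
    using \<nu> by (auto intro: less_imp_le)
  obtain g r where r: "strict_mono (r :: nat \<Rightarrow> nat)"
    and lim: "\<And>K. compact K \<Longrightarrow> K \<subseteq> U \<Longrightarrow>
      uniform_limit K ((\<lambda>i. sphere_ext (Q c ms m (\<nu> i))) \<circ> r) g sequentially"
    using normal[unfolded normal_on_def, rule_format, OF range] by auto
  have "open (Fin -` U)" using continuous_open_vimage[OF U(1)] continuous_Fin
    by (metis continuous_on_eq_continuous_at open_UNIV UNIV_I)
  then obtain \<epsilon> where \<epsilon>: "0 < \<epsilon>" "cball z \<epsilon> \<subseteq> Fin -` U"
    using U(2) open_contains_cball by blast
  have ulim: "uniform_limit (Fin ` cball z \<epsilon>) ((\<lambda>i. sphere_ext (Q c ms m (\<nu> i))) \<circ> r) g sequentially"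
    using \<epsilon>(2) by (intro lim compact_continuous_image continuous_on_subset[OF continuous_Fin]) auto
  then have ulim': "uniform_limit (cball z \<epsilon>) (\<lambda>i w. Fin (Q c ms m (\<nu> (r i)) w)) (g \<circ> Fin) sequentially"
    unfolding uniform_limit_iff by (simp add: sphere_ext_def)
  have "continuous_on (cball z \<epsilon>) (g \<circ> Fin)"
    by (rule uniform_limit_theorem[OF _ ulim'])
      (auto intro!: always_eventually continuous_on_compose2[OF continuous_Fin]
        intro: continuous_on_subset[OF continuous_Q])
  then have closed: "closed (cball z \<epsilon> \<inter> (g \<circ> Fin) -` {Infty})"
    by (intro continuous_closed_preimage) auto
  have limit: "(\<lambda>i. Fin (Q c ms m (\<nu> (r i)) w)) \<longlonglongrightarrow> g (Fin w)" if "w \<in> cball z \<epsilon>" for w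
    using tendsto_uniform_limitI[OF ulim' that] by simp
  have "g (Fin w) = Infty" if w: "w \<in> cball z \<epsilon>" "w \<notin> survivors m" for w
  proof -
    obtain k where k: "m < M ms k" "2 < cmod (Q c ms m (M ms k) w)"
      using w(2) unfolding survivors_def by (auto simp: not_le)
    have "(\<lambda>n. sphere_ext (Q c ms m n) (Fin w)) \<longlonglongrightarrow> Infty"
      by (rule tendsto_uniform_limitI[OF uniform_escape[of m k]]) (use k in auto)
    moreover have "filterlim (\<lambda>i. \<nu> (r i)) at_top sequentially"
    proof -
      have "strict_mono \<nu>" unfolding strict_mono_def \<nu>_def by (simp add: strict_mono_less[OF strict_mono_M])
      then show ?thesis using strict_mono_o[OF _ r, of \<nu>] filterlim_subseq by (auto simp: comp_def)
    qed
    ultimately have "(\<lambda>i. Fin (Q c ms m (\<nu> (r i)) w)) \<longlonglongrightarrow> Infty"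
      using filterlim_compose by (fastforce simp: sphere_ext_def)
    then show ?thesis using limit[OF w(1)] LIMSEQ_unique by blast
  qed
  then have sub: "ball z \<epsilon> \<inter> - survivors m \<subseteq> cball z \<epsilon> \<inter> (g \<circ> Fin) -` {Infty}" by auto
  have "z \<in> ball z \<epsilon> \<inter> closure (- survivors m)" using \<epsilon>(1) dense by simp
  also have "\<dots> \<subseteq> closure (ball z \<epsilon> \<inter> - survivors m)" by (rule open_Int_closure_subset) simp
  also have "\<dots> \<subseteq> cball z \<epsilon> \<inter> (g \<circ> Fin) -` {Infty}" by (rule closure_minimal[OF sub closed])
  finally have "g (Fin z) = Infty" by simp
  moreover have "g (Fin z) \<in> Fin ` cball 0 2"
  proof (rule Lim_in_closed_set[OF _ _ _ limit])
    show "closed (Fin ` cball 0 2)" by (rule closed_Fin_compact_image) simp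
    show "\<forall>\<^sub>F i in sequentially. Fin (Q c ms m (\<nu> (r i)) z) \<in> Fin ` cball 0 2"
      using z \<nu> unfolding survivors_def \<nu>_def by (intro always_eventually allI imageI) simp
  qed (use \<epsilon> in auto)
  ultimately show False by auto
qed

lemma Julia_eq_survivors:
  assumes "survivors m \<subseteq> closure (- survivors m)"
  shows "Julia c ms m = Fin ` survivors m"
  using Julia_subset_survivors survivor_in_Julia assms by blast

end

context cantor
begin

text \<open>The annuli of pointwise thinness are free of points of \<open>E\<close> and arbitrarily small.\<close>

lemma complement_E_dense: "E \<subseteq> closure (- E)"
proof
  fix z assume z: "z \<in> E"
  show "z \<in> closure (- E)"
    unfolding closure_approachable
  proof (intro allI impI)
    fix e :: real assume e: "0 < e"
    obtain r R :: "nat \<Rightarrow> real" where rR: "\<And>n. 0 < r n" "\<And>n. r n < R n" "R \<longlonglongrightarrow> 0"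
      and sep: "\<And>n. separates (annulus z (r n) (R n)) E"
      using pointwise_thin_E z unfolding pointwise_thin_def by blast
    obtain n where n: "R n < e"
      using order_tendstoD(2)[OF rR(3) e] unfolding eventually_sequentially by blast
    define w where "w = z + of_real ((r n + R n) / 2)"
    have dist: "cmod (w - z) = (r n + R n) / 2"
      unfolding w_def using rR(1)[of n] rR(2)[of n] by (simp del: of_real_divide of_real_add)
    then have "w \<in> annulus z (r n) (R n)" using rR(2)[of n] by (simp add: annulus_def)
    then have "w \<in> - E" using sep[of n] unfolding separates_def by blast
    moreover have "dist w z < e" using dist n rR(2)[of n] by (simp add: dist_norm)
    ultimately show "\<exists>y\<in>- E. dist y z < e" by blast
  qed
qed

end

section \<open>A choice of parameters\<close>

definition shift :: "nat \<Rightarrow> complex" where "shift k = of_real (64 ^ k)"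

definition squarings :: "nat \<Rightarrow> nat" where "squarings k = 7 * k\<^sup>2"

lemma le_square: "(k::nat) \<le> k\<^sup>2"
  by (cases k) (auto simp: power2_eq_square)

text \<open>Both sides are powers of 2, with exponents \<open>3 * k + 1\<close> and \<open>2 ^ (7 * k\<^sup>2)\<close>.\<close>

lemma parameter_blocks:
  assumes "1 \<le> k"
  shows "2 * sqrt (cmod (shift k)) \<le> 2 ^ 2 ^ squarings k"
proof -
  have "cmod (shift k) = (8 ^ k)\<^sup>2"
    unfolding shift_def norm_of_real by (simp flip: power_mult power_mult_distrib add: power2_eq_square)
  then have "2 * sqrt (cmod (shift k)) = 2 * 8 ^ k" by (simp del: power_mult)
  also have "\<dots> = 2 ^ (3 * k + 1)" by (simp add: power_mult)
  also have "\<dots> \<le> 2 ^ 2 ^ squarings k"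
  proof (rule power_increasing)
    have "3 * k + 1 \<le> squarings k" unfolding squarings_def using le_square[of k] assms by linarith
    also have "\<dots> < 2 ^ squarings k" by (rule less_exp)
    finally show "3 * k + 1 \<le> 2 ^ squarings k" by simp
  qed simp
  finally show ?thesis .
qed

interpretation quadratic_blocks shift squarings
  by unfold_locales (use parameter_blocks in \<open>auto simp: squarings_def\<close>)

definition first_block :: "nat \<Rightarrow> nat" where
  "first_block m = (LEAST k. m < M squarings k)"

definition degree_seq :: "nat \<Rightarrow> nat \<Rightarrow> nat" where
  "degree_seq m i = (if i = 0 then 2 ^ (M squarings (first_block m) - m)
     else 2 ^ (squarings (first_block m + i) + 1))"

definition shift_seq :: "nat \<Rightarrow> nat \<Rightarrow> real" where
  "shift_seq m i = 64 ^ (first_block m + i)"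

lemma first_block: "m < M squarings (first_block m)"
  unfolding first_block_def by (rule LeastI) (rule M_gt)

lemma first_block_pos: "1 \<le> first_block m"
  using first_block[of m] by (cases "first_block m") (auto simp: M_0)

lemma less_M_iff: "m < M squarings k \<longleftrightarrow> first_block m \<le> k"
proof
  show "first_block m \<le> k" if "m < M squarings k" unfolding first_block_def using that by (rule Least_le)
  show "m < M squarings k" if "first_block m \<le> k"
    using first_block[of m] M_mono[OF that, of squarings] by simp
qed

text \<open>With \<open>K = first_block m + i\<close>, the growth condition on the degrees amounts to
  \<open>7 * K * s \<le> (7 * K\<^sup>2 + 1) * (1 - s)\<close>, which holds once \<open>K \<ge> s / (1 - s)\<close>; this is why the number of
  squarings is quadratic in the index of the block.\<close>

interpretation stage: cantor "degree_seq m" "shift_seq m" for m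
proof
  let ?k = "\<lambda>i. first_block m + i"
  have k1: "1 \<le> ?k i" for i using first_block_pos[of m] by simp
  have c_le: "(64::real) ^ k + 2 \<le> 2 ^ (7 * k)" if "1 \<le> k" for k
  proof -
    have "(64::real) ^ 1 \<le> 64 ^ k" using that by (intro power_increasing) auto
    moreover have "(2::real) ^ 1 \<le> 2 ^ k" using that by (intro power_increasing) auto
    then have "(2::real) * 64 ^ k \<le> 2 ^ k * 64 ^ k" by (intro mult_right_mono) auto
    moreover have "(2::real) ^ (7 * k) = 2 ^ k * 64 ^ k"
      by (simp add: power_mult flip: power_mult_distrib)
    ultimately show ?thesis unfolding power_one_right by linarith
  qed
  show "2 \<le> degree_seq m i" for i
  proof -
    have "2 \<le> (2::nat) ^ n" if "0 < n" for n
      using power_increasing[of 1 n "2::nat"] that by simp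
    then show ?thesis unfolding degree_seq_def using first_block[of m] by auto
  qed
  have "(64::real) ^ 1 \<le> 64 ^ ?k i" for i using k1[of i] by (intro power_increasing) auto
  then show "16 \<le> shift_seq m i" for i unfolding shift_seq_def by (smt (verit) power_one_right)
  show "64 ^ i \<le> shift_seq m i" for i unfolding shift_seq_def by (intro power_increasing) auto
  show "shift_seq m i + 2 \<le> 2 ^ degree_seq m i" if "0 < i" for i
  proof -
    have "shift_seq m i + 2 \<le> 2 ^ (7 * ?k i)" unfolding shift_seq_def by (rule c_le[OF k1])
    also have "\<dots> \<le> 2 ^ degree_seq m i"
    proof (rule power_increasing)
      have "7 * ?k i < 2 ^ (7 * ?k i)" by (rule less_exp)
      also have "\<dots> \<le> degree_seq m i"
      proof -
        have "(2::nat) ^ (7 * ?k i) \<le> 2 ^ (squarings (?k i) + 1)"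
          unfolding squarings_def
          by (intro power_increasing trans_le_add1 mult_le_mono2 le_square) simp
        then show ?thesis unfolding degree_seq_def using that by simp
      qed
      finally show "7 * ?k i \<le> degree_seq m i" by simp
    qed simp
    finally show ?thesis .
  qed
  show "\<exists>n. \<forall>i\<ge>n. (shift_seq m i + 2) powr s \<le> real (degree_seq m i) powr (1 - s)"
    if s: "0 < s" "s < 1" for s
  proof -
    obtain n :: nat where n: "s / (1 - s) < real n" using reals_Archimedean2 by blast
    have "(shift_seq m i + 2) powr s \<le> real (degree_seq m i) powr (1 - s)" if i: "Suc n \<le> i" for i
    proof -
      let ?K = "real (?k i)"
      have "(shift_seq m i + 2) powr s \<le> (2 ^ (7 * ?k i)) powr s"
        unfolding shift_seq_def using c_le[OF k1[of i]] s by (intro powr_mono2) auto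
      also have "\<dots> = 2 powr (7 * ?K * s)" by (simp add: powr_powr flip: powr_realpow)
      also have "\<dots> \<le> 2 powr ((7 * ?K\<^sup>2 + 1) * (1 - s))"
      proof (rule powr_mono)
        have "s \<le> real n * (1 - s)" using n s by (simp add: divide_less_eq less_imp_le)
        also have "\<dots> \<le> ?K * (1 - s)" using i s by (intro mult_right_mono) auto
        finally have "7 * ?K * s \<le> 7 * ?K * (?K * (1 - s))" by (intro mult_left_mono) auto
        also have "\<dots> \<le> (7 * ?K\<^sup>2 + 1) * (1 - s)"
          using s by (simp add: power2_eq_square algebra_simps)
        finally show "7 * ?K * s \<le> (7 * ?K\<^sup>2 + 1) * (1 - s)" .
      qed simp
      also have "\<dots> = real (degree_seq m i) powr (1 - s)"
      proof -
        have "real (degree_seq m i) = 2 ^ (squarings (?k i) + 1)" using i by (simp add: degree_seq_def)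
        also have "\<dots> = 2 powr (7 * ?K\<^sup>2 + 1)"
          unfolding powr_realpow[symmetric, OF zero_less_numeral] squarings_def
          by (simp add: add.commute)
        finally show ?thesis by (simp add: powr_powr)
      qed
      finally show ?thesis .
    qed
    then show ?thesis by blast
  qed
qed

lemma stage_F: "stage.F m (Suc i) z = Q shift squarings m (M squarings (first_block m + i)) z"
proof (induction i)
  case 0
  obtain k where k: "first_block m = Suc k" using first_block_pos[of m] by (cases "first_block m") auto
  have "M squarings k \<le> m" using less_M_iff[of m k] k by simp
  then have "Q shift squarings m (M squarings (Suc k)) z
      = Q shift squarings m m z ^ 2 ^ (M squarings (Suc k) - m) + shift (Suc k)"
    using first_block[of m] k by (intro Q_M_Suc) auto
  moreover have "Q shift squarings m m z = z" by (cases m) auto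
  ultimately show ?case
    unfolding stage.F.simps by (simp add: k degree_seq_def shift_seq_def shift_def[of "Suc k"])
next
  case (Suc i)
  let ?k = "first_block m + i"
  have "m \<le> M squarings ?k" using less_M_iff[of m ?k] by simp
  then have "Q shift squarings m (M squarings (Suc ?k)) z
      = Q shift squarings m (M squarings ?k) z ^ 2 ^ (M squarings (Suc ?k) - M squarings ?k)
        + shift (Suc ?k)"
    by (intro Q_M_Suc) (auto simp: M_Suc)
  then show ?case
    unfolding stage.F.simps(2)[of m "Suc i"] Suc
    by (simp add: M_Suc degree_seq_def shift_seq_def shift_def[of "Suc ?k"])
qed

lemma stage_E: "stage.E m = survivors m"
proof -
  have "(\<forall>k\<ge>first_block m. cmod (Q shift squarings m (M squarings k) z) \<le> 2) \<longleftrightarrow>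
      (\<forall>i. cmod (Q shift squarings m (M squarings (first_block m + i)) z) \<le> 2)" for z
    using le_Suc_ex[of "first_block m"] by (metis le_add1)
  then show ?thesis unfolding stage.E_def survivors_def stage_F less_M_iff by simp
qed

theorem theorem1p8:
  shows "\<exists>(c :: nat \<Rightarrow> complex) (ms :: nat \<Rightarrow> nat).
    (\<forall>k\<ge>1. cmod (c k) > 4) \<and>
    (\<forall>k\<ge>1. ms k > 0) \<and>
    (\<forall>k\<ge>1. (2::real) ^ (2 ^ ms k) \<ge> 2 * sqrt (cmod (c k))) \<and>
    (\<forall>m. \<exists>E :: complex set. Julia c ms m = Fin ` E \<and>
           pointwise_thin E \<and> HNUP E \<and> HD E = 1)"
proof (intro exI conjI allI impI)
  fix k :: nat assume k: "1 \<le> k"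
  have "(64::real) ^ 1 \<le> 64 ^ k" using k by (intro power_increasing) auto
  then show "4 < cmod (shift k)" unfolding shift_def norm_of_real by simp
  show "0 < squarings k" using k by (rule ms_pos)
  show "2 * sqrt (cmod (shift k)) \<le> 2 ^ 2 ^ squarings k" using k by (rule parameter_blocks)
next
  fix m
  show "Julia shift squarings m = Fin ` stage.E m"
    unfolding stage_E using stage.complement_E_dense[of m]
    by (intro Julia_eq_survivors) (simp add: stage_E)
  show "pointwise_thin (stage.E m)" by (rule stage.pointwise_thin_E)
  show "HNUP (stage.E m)" by (rule stage.HNUP_E)
  show "HD (stage.E m) = 1" by (rule stage.HD_E)
qed

end
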